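(* There is a polynomial-time algorithm that, given a graph $G$ and a positive integer $k$, does one of the following: (i) correctly concludes that $G$ admits a partial Grundy coloring using at least $k$ colors; or (ii) outputs at most $2k^3$ induced subgraphs $A_1,\dots,A_\ell$ of $G$, each of which is a biclique, such that for every $v\in V(G)$ the degree of $v$ in $G-F$ is at most $k^3$, where $F=\bigcup_{t\in[\ell]}E(A_t)$.
   Context: A partial Grundy coloring of $G$ using $k'$ colors is a proper coloring $c:V(G)\to[k']$ such that for every $i\in[k']$ there is a vertex $v$ with $c(v)=i$ which, for every $j\in[i-1]$, has a neighbor $u$ with $c(u)=j$; "using at least $k$ colors" means for some $k'\ge k$. A biclique is a bipartite graph with bipartition $(L,R)$, $L,R\neq\emptyset$, in which every vertex of $L$ is adjacent to every vertex of $R$. For $F\subseteq E(G)$, $G-F$ is the graph $(V(G),E(G)\setminus F)$. *)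

theory Defs
  imports "HOL-Computational_Algebra.Polynomial"
begin

section \<open>Graphs\<close>

record 'a ugraph =
  verts :: "'a set"
  edges :: "'a set set"

definition finite_simple_graph :: "'a ugraph \<Rightarrow> bool" where
  "finite_simple_graph G \<longleftrightarrow>
     finite (verts G) \<and> (\<forall>e\<in>edges G. e \<subseteq> verts G \<and> card e = 2)"

definition neighbors :: "'a ugraph \<Rightarrow> 'a \<Rightarrow> 'a set" where
  "neighbors G v = {u. {v, u} \<in> edges G}"

definition degree_in :: "'a ugraph \<Rightarrow> 'a \<Rightarrow> nat" where
  "degree_in G v = card (neighbors G v)"

definition delete_edges :: "'a ugraph \<Rightarrow> 'a set set \<Rightarrow> 'a ugraph" where
  "delete_edges G F = \<lparr>verts = verts G, edges = edges G - F\<rparr>"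

definition is_induced_subgraph :: "'a ugraph \<Rightarrow> 'a ugraph \<Rightarrow> bool" where
  "is_induced_subgraph A G \<longleftrightarrow>
     verts A \<subseteq> verts G \<and> edges A = {e \<in> edges G. e \<subseteq> verts A}"

definition bipartition :: "'a ugraph \<Rightarrow> 'a set \<Rightarrow> 'a set \<Rightarrow> bool" where
  "bipartition G L R \<longleftrightarrow>
     L \<union> R = verts G \<and> L \<inter> R = {} \<and>
     (\<forall>e\<in>edges G. \<exists>x\<in>L. \<exists>y\<in>R. e = {x, y})"

definition biclique :: "'a ugraph \<Rightarrow> bool" where
  "biclique G \<longleftrightarrow>
     (\<exists>L R. bipartition G L R \<and> L \<noteq> {} \<and> R \<noteq> {} \<and>
            (\<forall>x\<in>L. \<forall>y\<in>R. {x, y} \<in> edges G))"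

definition proper_coloring :: "'a ugraph \<Rightarrow> nat \<Rightarrow> ('a \<Rightarrow> nat) \<Rightarrow> bool" where
  "proper_coloring G m c \<longleftrightarrow>
     c ` verts G \<subseteq> {1..m} \<and>
     (\<forall>u\<in>verts G. \<forall>v\<in>verts G. {u, v} \<in> edges G \<longrightarrow> c u \<noteq> c v)"

definition partial_Grundy_coloring :: "'a ugraph \<Rightarrow> nat \<Rightarrow> ('a \<Rightarrow> nat) \<Rightarrow> bool" where
  "partial_Grundy_coloring G m c \<longleftrightarrow>
     proper_coloring G m c \<and>
     (\<forall>i\<in>{1..m}. \<exists>v\<in>verts G. c v = i \<and>
        (\<forall>j\<in>{1..<i}. \<exists>u\<in>neighbors G v. c u = j))"

definition has_partial_Grundy_coloring_with_at_least :: "'a ugraph \<Rightarrow> nat \<Rightarrow> bool" where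
  "has_partial_Grundy_coloring_with_at_least G k \<longleftrightarrow>
     (\<exists>m\<ge>k. \<exists>c. partial_Grundy_coloring G m c)"


section \<open>Model of computation\<close>

text \<open>
  The WHILE language over binary trees (N. D. Jones, Computability and Complexity from a
  Programming Perspective). Instead of unit costs, every evaluation of a (sub)expression is
  charged the full size of its value, so that sharing cannot be used to build large trees
  cheaply, and a run of cost \<open>t\<close> can be simulated by a Turing machine in time polynomial
  in \<open>t\<close> and the input size; conversely, Turing machines are simulated with polynomial overhead.
\<close>

datatype tree = Leaf | Node tree tree

fun tree_size :: "tree \<Rightarrow> nat" where
  "tree_size Leaf = 1"
| "tree_size (Node a b) = tree_size a + tree_size b + 1"

fun left :: "tree \<Rightarrow> tree" where
  "left Leaf = Leaf"
| "left (Node a b) = a"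

fun right :: "tree \<Rightarrow> tree" where
  "right Leaf = Leaf"
| "right (Node a b) = b"

definition tree_of_bool :: "bool \<Rightarrow> tree" where
  "tree_of_bool b = (if b then Node Leaf Leaf else Leaf)"

datatype expr =
    Var nat
  | Lit tree
  | NodeE expr expr
  | LeftE expr
  | RightE expr
  | EqE expr expr

type_synonym store = "nat \<Rightarrow> tree"

fun eval :: "expr \<Rightarrow> store \<Rightarrow> tree" where
  "eval (Var x) s = s x"
| "eval (Lit a) s = a"
| "eval (NodeE e f) s = Node (eval e s) (eval f s)"
| "eval (LeftE e) s = left (eval e s)"
| "eval (RightE e) s = right (eval e s)"
| "eval (EqE e f) s = tree_of_bool (eval e s = eval f s)"

fun eval_cost :: "expr \<Rightarrow> store \<Rightarrow> nat" where
  "eval_cost (Var x) s = tree_size (s x)"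
| "eval_cost (Lit a) s = tree_size a"
| "eval_cost (NodeE e f) s =
     eval_cost e s + eval_cost f s + tree_size (eval (NodeE e f) s)"
| "eval_cost (LeftE e) s = eval_cost e s + tree_size (eval (LeftE e) s)"
| "eval_cost (RightE e) s = eval_cost e s + tree_size (eval (RightE e) s)"
| "eval_cost (EqE e f) s =
     eval_cost e s + eval_cost f s + tree_size (eval (EqE e f) s)"

datatype com =
    Skip
  | Assign nat expr
  | Seq com com
  | If expr com com
  | While expr com

text \<open>\<open>exec c s t s'\<close>: started in \<open>s\<close>, the command \<open>c\<close> terminates in \<open>s'\<close> at cost \<open>t\<close>.
  Every tree other than \<open>Leaf\<close> counts as true.\<close>

inductive exec :: "com \<Rightarrow> store \<Rightarrow> nat \<Rightarrow> store \<Rightarrow> bool" where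
  Skip: "exec Skip s 1 s"
| Assign: "exec (Assign x e) s (1 + eval_cost e s) (s(x := eval e s))"
| Seq: "exec c s t s' \<Longrightarrow> exec d s' t' s'' \<Longrightarrow> exec (Seq c d) s (t + t') s''"
| IfTrue: "eval e s \<noteq> Leaf \<Longrightarrow> exec c s t s' \<Longrightarrow>
     exec (If e c d) s (1 + eval_cost e s + t) s'"
| IfFalse: "eval e s = Leaf \<Longrightarrow> exec d s t s' \<Longrightarrow>
     exec (If e c d) s (1 + eval_cost e s + t) s'"
| WhileFalse: "eval e s = Leaf \<Longrightarrow> exec (While e c) s (1 + eval_cost e s) s"
| WhileTrue: "eval e s \<noteq> Leaf \<Longrightarrow> exec c s t s' \<Longrightarrow> exec (While e c) s' t' s'' \<Longrightarrow>
     exec (While e c) s (1 + eval_cost e s + t + t') s''"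

lemma exec_deterministic:
  "exec c s t s' \<Longrightarrow> exec c s u s'' \<Longrightarrow> t = u \<and> s' = s''"
proof (induction arbitrary: u s'' rule: exec.induct)
  case (Skip s)
  from Skip.prems show ?case by cases simp
next
  case (Assign x e s)
  from Assign.prems show ?case by cases simp
next
  case (Seq c s t s1 d t' s2)
  note IH = Seq.IH
  from Seq.prems show ?case
  proof cases
    case (Seq v r w)
    have 1: "t = v \<and> s1 = r" using IH(1)[OF Seq(2)] .
    have "exec d s1 w s''" using 1 Seq(3) by simp
    from IH(2)[OF this] 1 Seq(1) show ?thesis by simp
  qed
next
  case (IfTrue e s c t s' d)
  note IH = IfTrue.IH and hyp = IfTrue.hyps(1)
  from IfTrue.prems show ?case
  proof cases
    case (IfTrue v)
    with IH[of v s''] show ?thesis by simp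
  next
    case (IfFalse v)
    with hyp show ?thesis by simp
  qed
next
  case (IfFalse e s d t s' c)
  note IH = IfFalse.IH and hyp = IfFalse.hyps(1)
  from IfFalse.prems show ?case
  proof cases
    case (IfTrue v)
    with hyp show ?thesis by simp
  next
    case (IfFalse v)
    with IH[of v s''] show ?thesis by simp
  qed
next
  case (WhileFalse e s c)
  note hyp = WhileFalse.hyps
  from WhileFalse.prems show ?case
  proof cases
    case WhileFalse
    then show ?thesis by simp
  next
    case (WhileTrue v r w)
    with hyp show ?thesis by simp
  qed
next
  case (WhileTrue e s c t s1 t' s2)
  note IH = WhileTrue.IH and hyp = WhileTrue.hyps(1)
  from WhileTrue.prems show ?case
  proof cases
    case WhileFalse
    with hyp show ?thesis by simp
  next
    case (WhileTrue v r w)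
    have 1: "t = v \<and> s1 = r" using IH(1)[OF WhileTrue(3)] .
    have "exec (While e c) s1 w s''" using 1 WhileTrue(4) by simp
    from IH(2)[OF this] 1 WhileTrue(1) show ?thesis by simp
  qed
qed

text \<open>Variable 0 holds the input and, at the end, the output; all other variables start out
  as \<open>Leaf\<close>.\<close>

definition computes :: "com \<Rightarrow> tree \<Rightarrow> nat \<Rightarrow> tree \<Rightarrow> bool" where
  "computes c x t y \<longleftrightarrow> (\<exists>s. exec c ((\<lambda>_. Leaf)(0 := x)) t s \<and> s 0 = y)"


section \<open>Encoding of instances and answers\<close>

definition enc_list :: "tree list \<Rightarrow> tree" where
  "enc_list xs = foldr Node xs Leaf"

definition enc_bits :: "bool list \<Rightarrow> tree" where
  "enc_bits bs = enc_list (map tree_of_bool bs)"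

text \<open>Binary representation, least significant bit first.\<close>

fun bits_of_nat :: "nat \<Rightarrow> bool list" where
  "bits_of_nat n = (if n = 0 then [] else odd n # bits_of_nat (n div 2))"

declare bits_of_nat.simps [simp del]

text \<open>Characteristic vector of a set of vertices of a graph with vertex set \<open>{..<n}\<close>.\<close>

definition enc_vertex_set :: "nat \<Rightarrow> nat set \<Rightarrow> tree" where
  "enc_vertex_set n S = enc_bits (map (\<lambda>v. v \<in> S) [0..<n])"

text \<open>The adjacency matrix, row by row.\<close>

definition enc_graph :: "nat \<Rightarrow> nat ugraph \<Rightarrow> tree" where
  "enc_graph n G = enc_list (map (\<lambda>v. enc_vertex_set n (neighbors G v)) [0..<n])"

definition enc_instance :: "nat \<Rightarrow> nat ugraph \<Rightarrow> nat \<Rightarrow> tree" where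
  "enc_instance n G k = Node (enc_graph n G) (enc_bits (bits_of_nat k))"

datatype answer = Enough_Colors | Subgraphs "nat ugraph list"

text \<open>An induced subgraph is determined by its vertex set, so only the latter is output.\<close>

fun enc_answer :: "nat \<Rightarrow> answer \<Rightarrow> tree" where
  "enc_answer n Enough_Colors = Leaf"
| "enc_answer n (Subgraphs As) =
     Node Leaf (enc_list (map (\<lambda>A. enc_vertex_set n (verts A)) As))"

fun correct_answer :: "nat ugraph \<Rightarrow> nat \<Rightarrow> answer \<Rightarrow> bool" where
  "correct_answer G k Enough_Colors \<longleftrightarrow> has_partial_Grundy_coloring_with_at_least G k"
| "correct_answer G k (Subgraphs As) \<longleftrightarrow>
     length As \<le> 2 * k ^ 3 \<and>
     (\<forall>A\<in>set As. is_induced_subgraph A G \<and> biclique A) \<and>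
     (\<forall>v\<in>verts G. degree_in (delete_edges G (\<Union>A\<in>set As. edges A)) v \<le> k ^ 3)"

end

theory Submission
  imports Defs
begin

text \<open>
  Peeling off maximal independent sets colors \<open>G\<close> so that every vertex sees all smaller colors;
  with at least \<open>k\<close> classes we are done. Otherwise consider each ordered pair \<open>(A, B)\<close> of
  classes and scan \<open>A\<close> by decreasing degree into \<open>B\<close>, maintaining a list \<open>W\<close> of centers in \<open>A\<close>
  and a set \<open>U\<close> of vertices of \<open>B\<close>. A vertex \<open>x\<close> becomes a center if every earlier center \<open>w\<close> has
  a neighbor in \<open>B\<close> that is outside \<open>U\<close> and not adjacent to \<open>x\<close>; one such neighbor per \<open>w\<close> enters
  \<open>U\<close>. Giving \<open>x\<close> and these new vertices color 1 and raising all older colors by 1 keeps every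
  center a witness of its color, so \<open>k\<close> centers give a partial Grundy coloring with \<open>k\<close> colors.
  If \<open>x\<close> is rejected because of \<open>w\<close>, then \<open>N(w) - U \<subseteq> N(x)\<close>, so the sets \<open>N(w) - U\<close> together
  with their common neighbors in \<open>A\<close> are bicliques, and \<open>deg x \<le> deg w\<close> bounds what remains of
  \<open>N(x)\<close> in \<open>B\<close> by \<open>|U| < k\<^sup>2\<close>.

  For the running time, functions between encoded types computable in polynomial time are closed
  under composition, pairing, conditionals and left folds whose accumulators stay polynomially
  small. The binary number \<open>k\<close> is only compared with lengths of lists, by a binary counter.
\<close>

text \<open>Coefficients in \<open>nat\<close> are nonnegative. Because of this monotonicity, an
  upper bound on a size may be substituted into a polynomial cost bound.\<close>

lemma poly_nat_mono: "m \<le> n \<Longrightarrow> poly (p :: nat poly) m \<le> poly p n"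
  by (induction p) (auto intro!: add_mono mult_mono)

lemma tree_size_pos [simp]: "1 \<le> tree_size a"
  by (cases a) auto

section \<open>Polynomial bounds\<close>

definition poly_bounded :: "('a \<Rightarrow> tree) \<Rightarrow> ('a \<Rightarrow> nat) \<Rightarrow> bool" where
  "poly_bounded e b \<longleftrightarrow> (\<exists>p. \<forall>x. b x \<le> poly p (tree_size (e x)))"

lemma poly_bounded_mono:
  "poly_bounded e b \<Longrightarrow> (\<And>x. b' x \<le> b x) \<Longrightarrow> poly_bounded e b'"
  unfolding poly_bounded_def by (meson order_trans)

lemma poly_bounded_const: "poly_bounded e (\<lambda>x. m)"
  unfolding poly_bounded_def by (rule exI[of _ "[:m:]"]) simp

lemma poly_bounded_size: "poly_bounded e (\<lambda>x. tree_size (e x))"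
  unfolding poly_bounded_def by (rule exI[of _ "[:0, 1:]"]) simp

lemma poly_bounded_add:
  assumes "poly_bounded e a" "poly_bounded e b"
  shows "poly_bounded e (\<lambda>x. a x + b x)"
proof -
  obtain p q where "\<forall>x. a x \<le> poly p (tree_size (e x))" "\<forall>x. b x \<le> poly q (tree_size (e x))"
    using assms unfolding poly_bounded_def by blast
  then show ?thesis
    unfolding poly_bounded_def by (intro exI[of _ "p + q"]) (auto intro: add_mono)
qed

lemma poly_bounded_mult:
  assumes "poly_bounded e a" "poly_bounded e b"
  shows "poly_bounded e (\<lambda>x. a x * b x)"
proof -
  obtain p q where "\<forall>x. a x \<le> poly p (tree_size (e x))" "\<forall>x. b x \<le> poly q (tree_size (e x))"
    using assms unfolding poly_bounded_def by blast
  then show ?thesis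
    unfolding poly_bounded_def by (intro exI[of _ "p * q"]) (auto intro: mult_mono)
qed

lemma poly_bounded_poly:
  assumes "poly_bounded e a"
  shows "poly_bounded e (\<lambda>x. poly p (a x))"
proof -
  obtain q where "\<forall>x. a x \<le> poly q (tree_size (e x))"
    using assms unfolding poly_bounded_def by blast
  then show ?thesis
    unfolding poly_bounded_def
    by (intro exI[of _ "pcompose p q"]) (auto simp: poly_pcompose intro: poly_nat_mono)
qed

lemmas poly_bounded_intros = poly_bounded_const poly_bounded_size poly_bounded_add
  poly_bounded_mult poly_bounded_poly

section \<open>Polynomial-time functions between encoded types\<close>

text \<open>The program may start in any store, and it leaves all variables above a fixed index
  unchanged; so programs compose without renaming variables.\<close>

definition runs_in :: "com \<Rightarrow> nat \<Rightarrow> tree \<Rightarrow> nat \<Rightarrow> tree \<Rightarrow> bool" where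
  "runs_in c N a b y \<longleftrightarrow>
     (\<forall>s. s 0 = a \<longrightarrow> (\<exists>t s'. exec c s t s' \<and> t \<le> b \<and> s' 0 = y \<and> (\<forall>i>N. s' i = s i)))"

text \<open>The output size is bounded along with the running time: in a composition the cost of the
  second program is polynomial in the size of the intermediate value.\<close>

definition ptime :: "('a \<Rightarrow> tree) \<Rightarrow> ('b \<Rightarrow> tree) \<Rightarrow> ('a \<Rightarrow> 'b) \<Rightarrow> bool" where
  "ptime e e' f \<longleftrightarrow>
     (\<exists>c N b. poly_bounded e b \<and> (\<forall>x. runs_in c N (e x) (b x) (e' (f x)))) \<and>
     poly_bounded e (\<lambda>x. tree_size (e' (f x)))"

lemma ptimeI:
  assumes "\<And>x. runs_in c N (e x) (b x) (e' (f x))" "poly_bounded e b"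
    "poly_bounded e (\<lambda>x. tree_size (e' (f x)))"
  shows "ptime e e' f"
  using assms unfolding ptime_def by blast

lemma ptime_size: "ptime e e' f \<Longrightarrow> poly_bounded e (\<lambda>x. tree_size (e' (f x)))"
  unfolding ptime_def by blast

lemma runs_inD:
  "runs_in c N a b y \<Longrightarrow> s 0 = a \<Longrightarrow>
    \<exists>t s'. exec c s t s' \<and> t \<le> b \<and> s' 0 = y \<and> (\<forall>i>N. s' i = s i)"
  unfolding runs_in_def by blast

lemma poly_bounded_comp:
  assumes "poly_bounded e' b" "poly_bounded e (\<lambda>x. tree_size (e' (f x)))"
  shows "poly_bounded e (\<lambda>x. b (f x))"
proof -
  obtain p where "\<forall>y. b y \<le> poly p (tree_size (e' y))"
    using assms(1) unfolding poly_bounded_def by blast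
  then show ?thesis
    by (intro poly_bounded_mono[OF poly_bounded_poly[OF assms(2), of p]]) auto
qed

lemma runs_in_weaken: "runs_in c N a b y \<Longrightarrow> N \<le> N' \<Longrightarrow> b \<le> b' \<Longrightarrow> runs_in c N' a b' y"
  unfolding runs_in_def by (metis le_less_trans order_trans)

lemma runs_in_Seq:
  assumes "runs_in c N a b y" "runs_in d N' y b' z"
  shows "runs_in (Seq c d) (max N N') a (b + b') z"
  unfolding runs_in_def
proof (intro allI impI)
  fix s :: store assume "s 0 = a"
  with assms(1) obtain t s' where 1: "exec c s t s'" "t \<le> b" "s' 0 = y" "\<And>i. i > N \<Longrightarrow> s' i = s i"
    by (blast dest: runs_inD)
  from assms(2) 1(3) obtain t' s'' where 2: "exec d s' t' s''" "t' \<le> b'" "s'' 0 = z"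
    "\<And>i. i > N' \<Longrightarrow> s'' i = s' i"
    by (blast dest: runs_inD)
  show "\<exists>t s'. exec (Seq c d) s t s' \<and> t \<le> b + b' \<and> s' 0 = z \<and> (\<forall>i>max N N'. s' i = s i)"
    using exec.Seq[OF 1(1) 2(1)] 1 2 by (auto intro!: exI add_mono)
qed

lemma tree_size_eval_le: "tree_size (eval f s) \<le> eval_cost f s"
  by (cases f) auto

lemma ptime_Assign:
  assumes "\<And>x s. s 0 = e x \<Longrightarrow> eval f s = e' (g x) \<and> 1 + eval_cost f s \<le> b x"
    and b: "poly_bounded e b"
  shows "ptime e e' g"
proof (rule ptimeI)
  show "runs_in (Assign 0 f) 0 (e x) (b x) (e' (g x))" for x
    unfolding runs_in_def
  proof (intro allI impI)
    fix s :: store assume "s 0 = e x"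
    with assms(1)[of s x] exec.Assign[of 0 f s]
    show "\<exists>t s'. exec (Assign 0 f) s t s' \<and> t \<le> b x \<and> s' 0 = e' (g x) \<and> (\<forall>i>0. s' i = s i)"
      by (intro exI conjI) (assumption, auto)
  qed
  show "poly_bounded e (\<lambda>x. tree_size (e' (g x)))"
  proof (rule poly_bounded_mono[OF b])
    fix x
    show "tree_size (e' (g x)) \<le> b x"
      \<comment> \<open>Any store with \<open>e x\<close> in variable 0 would do; evaluation costs
        at least the size of its value, so \<open>b\<close> also bounds the output.\<close>
      using assms(1)[of "\<lambda>_. e x" x] tree_size_eval_le[of f "\<lambda>_. e x"] by auto
  qed
qed (rule b)

section \<open>Closure under composition, pairing, conditionals and equality tests\<close>

lemma ptime_comp:
  assumes "ptime e e1 f" "ptime e1 e2 g"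
  shows "ptime e e2 (\<lambda>x. g (f x))"
proof -
  obtain c N b where c: "\<And>x. runs_in c N (e x) (b x) (e1 (f x))" "poly_bounded e b"
    using assms(1) unfolding ptime_def by blast
  obtain d M b' where d: "\<And>y. runs_in d M (e1 y) (b' y) (e2 (g y))" "poly_bounded e1 b'"
    using assms(2) unfolding ptime_def by blast
  show ?thesis
    by (rule ptimeI, rule runs_in_Seq[OF c(1) d(1)],
      intro poly_bounded_add c(2) poly_bounded_comp[OF d(2)] ptime_size assms,
      rule poly_bounded_comp[OF ptime_size ptime_size]) (rule assms)+
qed

lemma ptime_id: "ptime e e (\<lambda>x. x)"
  by (rule ptime_Assign[where f = "Var 0" and b = "\<lambda>x. 1 + tree_size (e x)"], simp)
    (intro poly_bounded_intros)

lemma ptime_const: "ptime e e1 (\<lambda>x. c)"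
  by (rule ptime_Assign[where f = "Lit (e1 c)" and b = "\<lambda>x. 1 + tree_size (e1 c)"], simp)
    (intro poly_bounded_intros)

text \<open>Only the output tree matters to \<open>ptime\<close>, so a result may be reread as a
  value of another type with the same tree, such as a pair of head and tail as a list.\<close>

lemma ptime_reencode:
  assumes "ptime e e1 f" "\<And>x. e1 (f x) = e2 (g x)"
  shows "ptime e e2 g"
  using assms unfolding ptime_def by simp

definition enc_pair :: "('a \<Rightarrow> tree) \<Rightarrow> ('b \<Rightarrow> tree) \<Rightarrow> 'a \<times> 'b \<Rightarrow> tree" where
  "enc_pair e f z = Node (e (fst z)) (f (snd z))"

lemma tree_size_left: "tree_size (left a) \<le> tree_size a"
  by (cases a) auto

lemma tree_size_right: "tree_size (right a) \<le> tree_size a"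
  by (cases a) auto

lemma ptime_left:
  assumes "\<And>x. e' (f x) = left (e x)"
  shows "ptime e e' f"
  by (rule ptime_Assign[where f = "LeftE (Var 0)" and b="\<lambda>x. 1 + (tree_size (e x) + tree_size (e x))"],
      simp add: assms tree_size_left) (intro poly_bounded_intros)

lemma ptime_right:
  assumes "\<And>x. e' (f x) = right (e x)"
  shows "ptime e e' f"
  by (rule ptime_Assign[where f = "RightE (Var 0)" and b="\<lambda>x. 1 + (tree_size (e x) + tree_size (e x))"],
      simp add: assms tree_size_right) (intro poly_bounded_intros)

lemma ptime_fst: "ptime e (enc_pair a b) f \<Longrightarrow> ptime e a (\<lambda>x. fst (f x))"
  by (erule ptime_comp) (simp add: ptime_left enc_pair_def)

lemma ptime_snd: "ptime e (enc_pair a b) f \<Longrightarrow> ptime e b (\<lambda>x. snd (f x))"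
  by (erule ptime_comp) (simp add: ptime_right enc_pair_def)

text \<open>With \<open>M\<close> the maximum of \<open>N\<close> and \<open>N'\<close>, neither
  program touches variables above \<open>M\<close>. So the input survives the first program in
  \<open>M+1\<close>, and the first result survives the second one in \<open>M+2\<close>.\<close>

lemma ptime_Pair:
  assumes "ptime e e1 f" "ptime e e2 g"
  shows "ptime e (enc_pair e1 e2) (\<lambda>x. (f x, g x))"
proof -
  obtain c N b where c: "\<And>x. runs_in c N (e x) (b x) (e1 (f x))" "poly_bounded e b"
    using assms(1) unfolding ptime_def by blast
  obtain d N' b' where d: "\<And>y. runs_in d N' (e y) (b' y) (e2 (g y))" "poly_bounded e b'"
    using assms(2) unfolding ptime_def by blast
  define M where "M = max N N'"
  define S where "S = (\<lambda>x. tree_size (e x) + tree_size (e1 (f x)) + tree_size (e2 (g x)))"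
  define C where "C = Seq (Assign (M+1) (Var 0)) (Seq c (Seq (Assign (M+2) (Var 0))
    (Seq (Assign 0 (Var (M+1))) (Seq d (Assign 0 (NodeE (Var (M+2)) (Var 0)))))))"
  have S: "poly_bounded e S"
    unfolding S_def by (intro poly_bounded_intros ptime_size assms)
  have "runs_in C (M+2) (e x) (10 + 10 * S x + b x + b' x) (enc_pair e1 e2 (f x, g x))" for x
    unfolding runs_in_def
  proof (intro allI impI)
    fix s :: store assume s: "s 0 = e x"
    define s1 where "s1 = s(M+1 := e x)"
    have "exec (Assign (M+1) (Var 0)) s (1 + tree_size (e x)) s1"
      using exec.Assign[of "M+1" "Var 0" s] s by (simp add: s1_def)
    moreover have "s1 0 = e x" by (simp add: s1_def s)
    with c(1) obtain t2 s2 where 2: "exec c s1 t2 s2" "t2 \<le> b x" "s2 0 = e1 (f x)"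
      "\<And>i. i > N \<Longrightarrow> s2 i = s1 i" by (blast dest: runs_inD)
    moreover define s3 where "s3 = s2(M+2 := e1 (f x))"
    have "exec (Assign (M+2) (Var 0)) s2 (1 + tree_size (e1 (f x))) s3"
      using exec.Assign[of "M+2" "Var 0" s2] 2 by (simp add: s3_def)
    moreover define s4 where "s4 = s3(0 := e x)"
    have "s3 (M+1) = e x" using 2(4)[of "M+1"] by (simp add: s3_def s1_def M_def)
    then have "exec (Assign 0 (Var (M+1))) s3 (1 + tree_size (e x)) s4"
      using exec.Assign[of 0 "Var (M+1)" s3] by (simp add: s4_def)
    moreover have "s4 0 = e x" by (simp add: s4_def)
    with d(1) obtain t5 s5 where 5: "exec d s4 t5 s5" "t5 \<le> b' x" "s5 0 = e2 (g x)"
      "\<And>i. i > N' \<Longrightarrow> s5 i = s4 i" by (blast dest: runs_inD)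
    moreover define s6 where "s6 = s5(0 := Node (e1 (f x)) (e2 (g x)))"
    have "s5 (M+2) = e1 (f x)" using 5(4)[of "M+2"] by (simp add: s4_def s3_def M_def)
    then have "exec (Assign 0 (NodeE (Var (M+2)) (Var 0))) s5
        (1 + (tree_size (e1 (f x)) + tree_size (e2 (g x)) +
          tree_size (Node (e1 (f x)) (e2 (g x))))) s6"
      using exec.Assign[of 0 "NodeE (Var (M+2)) (Var 0)" s5] 5(3) by (simp add: s6_def)
    ultimately have ex: "exec C s ((1 + tree_size (e x)) + (t2 + ((1 + tree_size (e1 (f x))) +
        ((1 + tree_size (e x)) + (t5 + (1 + (tree_size (e1 (f x)) + tree_size (e2 (g x)) +
          tree_size (Node (e1 (f x)) (e2 (g x)))))))))) s6"
      unfolding C_def by (blast intro: exec.Seq)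
    have "s6 i = s i" if "i > M + 2" for i
      using that 2(4)[of i] 5(4)[of i] by (simp add: s6_def s4_def s3_def s1_def M_def)
    moreover have "s6 0 = enc_pair e1 e2 (f x, g x)" by (simp add: s6_def enc_pair_def)
    ultimately show "\<exists>t s'. exec C s t s' \<and> t \<le> 10 + 10 * S x + b x + b' x \<and>
        s' 0 = enc_pair e1 e2 (f x, g x) \<and> (\<forall>i>M+2. s' i = s i)"
      using ex 2(2) 5(2) by (intro exI[of _ s6] exI) (auto simp: S_def)
  qed
  then show ?thesis
    by (rule ptimeI, intro poly_bounded_intros c(2) d(2) S)
      (unfold enc_pair_def fst_conv snd_conv tree_size.simps, intro poly_bounded_intros ptime_size assms)
qed

text \<open>The condition is computed together with a copy of the input. After unpacking, the chosen
  branch finds the input in variable 0 as it expects, while the condition waits in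
  \<open>M+1\<close>.\<close>

lemma ptime_If:
  assumes "ptime e tree_of_bool h" "ptime e e1 f" "ptime e e1 g"
  shows "ptime e e1 (\<lambda>x. if h x then f x else g x)"
proof -
  obtain c N b where c: "\<And>x. runs_in c N (e x) (b x) (e1 (f x))" "poly_bounded e b"
    using assms(2) unfolding ptime_def by blast
  obtain d N' b' where d: "\<And>y. runs_in d N' (e y) (b' y) (e1 (g y))" "poly_bounded e b'"
    using assms(3) unfolding ptime_def by blast
  obtain k K a where k: "\<And>x. runs_in k K (e x) (a x) (enc_pair tree_of_bool e (h x, x))" "poly_bounded e a"
    using ptime_Pair[OF assms(1) ptime_id] unfolding ptime_def by blast
  define M where "M = max K (max N N')"
  have MK: "K \<le> M" "N \<le> M" "N' \<le> M" by (auto simp: M_def)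
  define C where "C = Seq k (Seq (Assign (M+1) (LeftE (Var 0))) (Seq (Assign 0 (RightE (Var 0)))
     (If (Var (M+1)) c d)))"
  have "runs_in C (M+1) (e x) (30 + 10 * tree_size (e x) + a x + b x + b' x)
     (e1 (if h x then f x else g x))" for x
    unfolding runs_in_def
  proof (intro allI impI)
    fix s :: store assume s: "s 0 = e x"
    with k(1) obtain t1 s1 where 1: "exec k s t1 s1" "t1 \<le> a x"
      "s1 0 = enc_pair tree_of_bool e (h x, x)" "\<And>i. i > K \<Longrightarrow> s1 i = s i" by (blast dest: runs_inD)
    let ?b = "tree_of_bool (h x)"
    have b3: "tree_size ?b \<le> 3" by (simp add: tree_of_bool_def)
    define s2 where "s2 = s1(M+1 := ?b)"
    have 2: "exec (Assign (M+1) (LeftE (Var 0))) s1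
        (1 + (tree_size (Node ?b (e x)) + tree_size ?b)) s2"
      using exec.Assign[of "M+1" "LeftE (Var 0)" s1] 1 by (simp add: s2_def enc_pair_def)
    define s3 where "s3 = s2(0 := e x)"
    have 3: "exec (Assign 0 (RightE (Var 0))) s2
        (1 + (tree_size (Node ?b (e x)) + tree_size (e x))) s3"
      using exec.Assign[of 0 "RightE (Var 0)" s2] 1 by (simp add: s2_def s3_def enc_pair_def)
    have s30: "s3 0 = e x" "s3 (M+1) = ?b" by (simp_all add: s3_def s2_def)
    have "\<exists>t s'. exec (If (Var (M+1)) c d) s3 t s' \<and> t \<le> 1 + tree_size ?b + b x + b' x \<and>
        s' 0 = e1 (if h x then f x else g x) \<and> (\<forall>i>M. s' i = s3 i)"
    proof (cases "h x")
      case True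
      from c(1) s30(1) obtain t s' where 4: "exec c s3 t s'" "t \<le> b x" "s' 0 = e1 (f x)"
        "\<And>i. i > N \<Longrightarrow> s' i = s3 i" by (blast dest: runs_inD)
      have "exec (If (Var (M+1)) c d) s3 (1 + eval_cost (Var (M+1)) s3 + t) s'"
        using 4(1) s30 True by (intro exec.IfTrue) (auto simp: tree_of_bool_def)
      with 4 True s30 show ?thesis by (intro exI[of _ s'] exI) (auto simp: M_def)
    next
      case False
      from d(1) s30(1) obtain t s' where 4: "exec d s3 t s'" "t \<le> b' x" "s' 0 = e1 (g x)"
        "\<And>i. i > N' \<Longrightarrow> s' i = s3 i" by (blast dest: runs_inD)
      have "exec (If (Var (M+1)) c d) s3 (1 + eval_cost (Var (M+1)) s3 + t) s'"
        using 4(1) s30 False by (intro exec.IfFalse) (auto simp: tree_of_bool_def)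
      with 4 False s30 show ?thesis by (intro exI[of _ s'] exI) (auto simp: M_def)
    qed
    then obtain t s' where 4: "exec (If (Var (M+1)) c d) s3 t s'" "t \<le> 1 + tree_size ?b + b x + b' x"
        "s' 0 = e1 (if h x then f x else g x)" "\<And>i. i > M \<Longrightarrow> s' i = s3 i" by blast
    have "exec C s (t1 + ((1 + (tree_size (Node ?b (e x)) + tree_size ?b)) +
        ((1 + (tree_size (Node ?b (e x)) + tree_size (e x))) + t))) s'"
      unfolding C_def using 1(1) 2 3 4(1) by (blast intro: exec.Seq)
    moreover have "s' i = s i" if "i > M + 1" for i
      using that 1(4)[of i] 4(4)[of i] MK by (simp add: s3_def s2_def)
    ultimately show "\<exists>t s'. exec C s t s' \<and> t \<le> 30 + 10 * tree_size (e x) + a x + b x + b' x \<and>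
       s' 0 = e1 (if h x then f x else g x) \<and> (\<forall>i>M + 1. s' i = s i)"
      using 4(2,3) 1(2) b3 by (intro exI[of _ s'] exI) auto
  qed
  then show ?thesis
    by (rule ptimeI, intro poly_bounded_intros c(2) d(2) k(2),
      intro poly_bounded_mono[OF poly_bounded_add[OF ptime_size[OF assms(2)] ptime_size[OF assms(3)]]])
      simp
qed

text \<open>\<open>EqE\<close> compares trees; injectivity of the encoding turns this into a
  comparison of values.\<close>

lemma ptime_eq:
  assumes "inj e1" "ptime e e1 f" "ptime e e1 g"
  shows "ptime e tree_of_bool (\<lambda>x. f x = g x)"
proof -
  have "ptime (enc_pair e1 e1) tree_of_bool (\<lambda>z. fst z = snd z)"
    by (rule ptime_Assign[where f = "EqE (LeftE (Var 0)) (RightE (Var 0))" and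
        b="\<lambda>z. 10 + 10 * tree_size (enc_pair e1 e1 z)"],
        simp add: enc_pair_def tree_of_bool_def inj_eq[OF assms(1)]) (intro poly_bounded_intros)
  from ptime_comp[OF ptime_Pair[OF assms(2,3)] this] show ?thesis by simp
qed

section \<open>Lists\<close>

definition enc_of_list :: "('a \<Rightarrow> tree) \<Rightarrow> 'a list \<Rightarrow> tree" where
  "enc_of_list e xs = enc_list (map e xs)"

lemma enc_of_list_simps [simp]:
  "enc_of_list e [] = Leaf" "enc_of_list e (x # xs) = Node (e x) (enc_of_list e xs)"
  by (simp_all add: enc_of_list_def enc_list_def)

lemma inj_enc_of_list: assumes "inj e" shows "inj (enc_of_list e)"
proof (rule injI)
  fix xs ys assume "enc_of_list e xs = enc_of_list e ys"
  then show "xs = ys"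
  proof (induction xs arbitrary: ys)
    case Nil then show ?case by (cases ys) auto
  next
    case (Cons x xs) then show ?case by (cases ys) (auto simp: inj_eq[OF assms])
  qed
qed

lemma inj_tree_of_bool: "inj tree_of_bool"
  by (auto simp: inj_def tree_of_bool_def)

lemma length_le_tree_size: "length xs \<le> tree_size (enc_of_list e xs)"
  by (induction xs) auto

lemma tree_size_elem: "x \<in> set xs \<Longrightarrow> tree_size (e x) \<le> tree_size (enc_of_list e xs)"
  by (induction xs) auto

lemma tree_size_enc_of_list_le:
  assumes "length xs \<le> m" "\<And>x. x \<in> set xs \<Longrightarrow> tree_size (e x) \<le> b"
  shows "tree_size (enc_of_list e xs) \<le> 1 + m * (1 + b)"
proof -
  have "tree_size (enc_of_list e xs) \<le> 1 + length xs * (1 + b)"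
    using assms(2)
  proof (induction xs)
    case (Cons a xs)
    then have "tree_size (enc_of_list e xs) \<le> 1 + length xs * (1 + b)" "tree_size (e a) \<le> b"
      by auto
    then show ?case by simp
  qed simp
  also have "\<dots> \<le> 1 + m * (1 + b)" using assms(1) by (intro add_left_mono mult_right_mono) auto
  finally show ?thesis .
qed

text \<open>Variable \<open>X\<close> keeps the context \<open>u\<close>, \<open>L\<close> the
  unread part of the list, and variable 0 the accumulator. The body is constrained only at
  accumulators reached after a prefix, which lets the induction move the start value: a prefix
  \<open>ys\<close> of the tail is the prefix \<open>b # ys\<close> of the whole list. One round
  costs \<open>T\<close> for the body, and \<open>20 + 20 * S\<close> leaves room for testing,
  packing the argument and advancing \<open>L\<close>.\<close>

lemma exec_While_foldl:
  assumes "X > N" "L > N" "X \<noteq> L" "X > 0" "L > 0"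
    and body: "\<And>ys b zs acc. xs = ys @ b # zs \<Longrightarrow> acc = foldl G a ys \<Longrightarrow>
      runs_in c N (Node u (Node (eb b) (ea acc))) T (ea (G acc b)) \<and> tree_size (ea acc) \<le> S"
    and "tree_size (enc_of_list eb xs) \<le> S" "tree_size u \<le> S"
    and "s X = u" "s L = enc_of_list eb xs" "s 0 = ea a"
  shows "\<exists>t s'. exec (While (Var L) (Seq (Assign 0 (NodeE (Var X) (NodeE (LeftE (Var L)) (Var 0))))
      (Seq c (Assign L (RightE (Var L)))))) s t s' \<and>
      t \<le> (1 + length xs) * (20 + 20 * S + T) \<and> s' 0 = ea (foldl G a xs) \<and>
      (\<forall>i>N. i \<noteq> L \<longrightarrow> s' i = s i)"
  using assms(6-)
proof (induction xs arbitrary: a s)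
  case Nil
  have "exec (While (Var L) c) s (1 + eval_cost (Var L) s) s" for c
    by (rule exec.WhileFalse) (use Nil in simp)
  then show ?case using Nil by (intro exI[of _ s] exI conjI) auto
next
  case (Cons b zs)
  let ?A = "Assign 0 (NodeE (Var X) (NodeE (LeftE (Var L)) (Var 0)))"
  let ?R = "Assign L (RightE (Var L))"
  let ?K = "20 + 20 * S + T"
  have G: "runs_in c N (Node u (Node (eb b) (ea a))) T (ea (G a b))" "tree_size (ea a) \<le> S"
    using Cons.prems(1)[of "[]" b zs a] by auto
  define s1 where "s1 = s(0 := Node u (Node (eb b) (ea a)))"
  obtain t1 where 1: "exec ?A s t1 s1" "t1 \<le> 10 + 10 * S"
    using exec.Assign[of 0 "NodeE (Var X) (NodeE (LeftE (Var L)) (Var 0))" s] Cons.prems(2-) G(2)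
    by (auto simp: s1_def)
  have "s1 0 = Node u (Node (eb b) (ea a))" by (simp add: s1_def)
  with G(1) obtain t2 s2 where 2: "exec c s1 t2 s2" "t2 \<le> T" "s2 0 = ea (G a b)"
    "\<And>i. i > N \<Longrightarrow> s2 i = s1 i" by (blast dest: runs_inD)
  have s2L: "s2 L = enc_of_list eb (b # zs)"
    using 2(4)[of L] assms Cons.prems by (simp add: s1_def)
  define s3 where "s3 = s2(L := enc_of_list eb zs)"
  obtain t3 where 3: "exec ?R s2 t3 s3" "t3 \<le> 1 + 2 * S"
    using exec.Assign[of L "RightE (Var L)" s2] Cons.prems(2) s2L by (auto simp: s3_def)
  have "\<exists>t s'. exec (While (Var L) (Seq ?A (Seq c ?R))) s3 t s' \<and>
      t \<le> (1 + length zs) * ?K \<and> s' 0 = ea (foldl G (G a b) zs) \<and>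
      (\<forall>i>N. i \<noteq> L \<longrightarrow> s' i = s3 i)"
  proof (rule Cons.IH)
    fix ys b' zs' acc assume "zs = ys @ b' # zs'" "acc = foldl G (G a b) ys"
    then show "runs_in c N (Node u (Node (eb b') (ea acc))) T (ea (G acc b')) \<and> tree_size (ea acc) \<le> S"
      using Cons.prems(1)[of "b # ys" b' zs' acc] by simp
  next
    show "tree_size (enc_of_list eb zs) \<le> S" using Cons.prems(2) by simp
    show "tree_size u \<le> S" by fact
    show "s3 X = u" using 2(4)[of X] assms(1-5) Cons.prems(4) by (simp add: s3_def s1_def)
    show "s3 L = enc_of_list eb zs" by (simp add: s3_def)
    show "s3 0 = ea (G a b)" using 2(3) assms(5) by (simp add: s3_def)
  qed
  then obtain t4 s4 where 4: "exec (While (Var L) (Seq ?A (Seq c ?R))) s3 t4 s4"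
     "t4 \<le> (1 + length zs) * ?K" "s4 0 = ea (foldl G (G a b) zs)"
     "\<And>i. i > N \<Longrightarrow> i \<noteq> L \<Longrightarrow> s4 i = s3 i" by blast
  have "exec (While (Var L) (Seq ?A (Seq c ?R))) s (1 + eval_cost (Var L) s + (t1 + (t2 + t3)) + t4) s4"
    by (rule exec.WhileTrue[OF _ _ 4(1)])
      (use Cons.prems in simp, rule exec.Seq[OF 1(1) exec.Seq[OF 2(1) 3(1)]])
  moreover have "1 + eval_cost (Var L) s + (t1 + (t2 + t3)) + t4 \<le> (1 + length (b # zs)) * ?K"
  proof -
    have "tree_size (s L) \<le> S" using Cons.prems(2,5) by simp
    then have "1 + eval_cost (Var L) s + (t1 + (t2 + t3)) \<le> ?K"
      using 1(2) 2(2) 3(2) by simp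
    with 4(2) show ?thesis by simp
  qed
  moreover have "s4 i = s i" if "i > N" "i \<noteq> L" for i
    using that 2(4)[of i] 4(4)[of i] by (simp add: s3_def s1_def)
  ultimately show ?case using 4(3)
    by (intro exI[of _ s4] exI conjI) (assumption, auto)
qed

text \<open>Iterating a polynomial-time step can blow up values exponentially, so the accumulators
  after all prefixes must be bounded by one polynomial \<open>q\<close> in the input. Every round
  then has an argument of polynomial size, and the number of rounds is at most the size of the
  list.\<close>

lemma ptime_foldl:
  assumes l: "ptime e (enc_of_list eb) l" and i: "ptime e ea i"
    and G: "ptime (enc_pair e (enc_pair eb ea)) ea (\<lambda>z. G (fst z) (snd (snd z)) (fst (snd z)))"
    and q: "poly_bounded e q"
    and bound: "\<And>x ys zs. l x = ys @ zs \<Longrightarrow> tree_size (ea (foldl (G x) (i x) ys)) \<le> q x"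
  shows "ptime e ea (\<lambda>x. foldl (G x) (i x) (l x))"
proof -
  obtain c N b where c: "\<And>x. runs_in c N (e x) (b x) (enc_of_list eb (l x))" "poly_bounded e b"
    using l unfolding ptime_def by blast
  obtain d N' b' where d: "\<And>y. runs_in d N' (e y) (b' y) (ea (i y))" "poly_bounded e b'"
    using i unfolding ptime_def by blast
  obtain g K a where g: "\<And>z. runs_in g K (enc_pair e (enc_pair eb ea) z) (a z)
     (ea (G (fst z) (snd (snd z)) (fst (snd z))))" "poly_bounded (enc_pair e (enc_pair eb ea)) a"
    using G unfolding ptime_def by blast
  obtain p where p: "\<And>z. a z \<le> poly p (tree_size (enc_pair e (enc_pair eb ea) z))"
    using g(2) unfolding poly_bounded_def by blast
  define M where "M = max K (max N N')"
  have MK: "K \<le> M" "N \<le> M" "N' \<le> M" by (auto simp: M_def)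
  define C where "C = Seq (Assign (M+1) (Var 0)) (Seq c (Seq (Assign (M+2) (Var 0))
    (Seq (Assign 0 (Var (M+1))) (Seq d (While (Var (M+2))
      (Seq (Assign 0 (NodeE (Var (M+1)) (NodeE (LeftE (Var (M+2))) (Var 0))))
      (Seq g (Assign (M+2) (RightE (Var (M+2)))))))))))"
  define S where "S = (\<lambda>x. tree_size (e x) + tree_size (enc_of_list eb (l x)) + q x)"
  define T where "T = (\<lambda>x. poly p (5 + 5 * S x))"
  define B where "B = (\<lambda>x. 10 + 10 * S x + b x + b' x + (1 + S x) * (20 + 20 * S x + T x))"
  have S: "poly_bounded e S" unfolding S_def by (intro poly_bounded_intros ptime_size l q)
  have T: "poly_bounded e T" unfolding T_def by (intro poly_bounded_intros S)
  have B: "poly_bounded e B" unfolding B_def by (intro poly_bounded_intros S T c d)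
  have "runs_in C (M+2) (e x) (B x) (ea (foldl (G x) (i x) (l x)))" for x
    unfolding runs_in_def
  proof (intro allI impI)
    fix s :: store assume s: "s 0 = e x"
    define s1 where "s1 = s(M+1 := e x)"
    have 1: "exec (Assign (M+1) (Var 0)) s (1 + tree_size (e x)) s1"
      using exec.Assign[of "M+1" "Var 0" s] s by (simp add: s1_def)
    have "s1 0 = e x" by (simp add: s1_def s)
    with c(1) obtain t2 s2 where 2: "exec c s1 t2 s2" "t2 \<le> b x" "s2 0 = enc_of_list eb (l x)"
      "\<And>i. i > N \<Longrightarrow> s2 i = s1 i" by (blast dest: runs_inD)
    define s3 where "s3 = s2(M+2 := enc_of_list eb (l x))"
    have 3: "exec (Assign (M+2) (Var 0)) s2 (1 + tree_size (enc_of_list eb (l x))) s3"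
      using exec.Assign[of "M+2" "Var 0" s2] 2 by (simp add: s3_def)
    define s4 where "s4 = s3(0 := e x)"
    have "s3 (M+1) = e x" using 2(4)[of "M+1"] by (simp add: s3_def s1_def M_def)
    then have 4: "exec (Assign 0 (Var (M+1))) s3 (1 + tree_size (e x)) s4"
      using exec.Assign[of 0 "Var (M+1)" s3] by (simp add: s4_def)
    have "s4 0 = e x" by (simp add: s4_def)
    with d(1) obtain t5 s5 where 5: "exec d s4 t5 s5" "t5 \<le> b' x" "s5 0 = ea (i x)"
      "\<And>i. i > N' \<Longrightarrow> s5 i = s4 i" by (blast dest: runs_inD)
    have "\<exists>t s'. exec (While (Var (M+2)) (Seq (Assign 0 (NodeE (Var (M+1)) (NodeE (LeftE (Var (M+2))) (Var 0))))
      (Seq g (Assign (M+2) (RightE (Var (M+2))))))) s5 t s' \<and>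
      t \<le> (1 + length (l x)) * (20 + 20 * S x + T x) \<and> s' 0 = ea (foldl (G x) (i x) (l x)) \<and>
      (\<forall>i>M. i \<noteq> M+2 \<longrightarrow> s' i = s5 i)"
    proof (rule exec_While_foldl)
      fix ys y zs acc assume ys: "l x = ys @ y # zs" "acc = foldl (G x) (i x) ys"
      have acc: "tree_size (ea acc) \<le> q x" using bound[of x ys "y # zs"] ys by simp
      have "tree_size (eb y) \<le> tree_size (enc_of_list eb (l x))"
        by (rule tree_size_elem) (simp add: ys)
      then have "tree_size (enc_pair e (enc_pair eb ea) (x, y, acc)) \<le> 5 + 5 * S x"
        using acc by (simp add: enc_pair_def S_def)
      then have "a (x, y, acc) \<le> T x"
        unfolding T_def using p[of "(x,y,acc)"] poly_nat_mono order_trans by blast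
      with g(1)[of "(x, y, acc)"]
      have "runs_in g M (Node (e x) (Node (eb y) (ea acc))) (T x) (ea (G x acc y))"
        by (auto simp: enc_pair_def M_def intro: runs_in_weaken)
      then show "runs_in g M (Node (e x) (Node (eb y) (ea acc))) (T x) (ea (G x acc y)) \<and>
        tree_size (ea acc) \<le> S x" using acc by (simp add: S_def)
    next
      show "s5 (M+1) = e x" using 5(4)[of "M+1"] \<open>s3 (M+1) = e x\<close> by (simp add: s4_def M_def)
      show "s5 (M+2) = enc_of_list eb (l x)" using 5(4)[of "M+2"] by (simp add: s4_def s3_def M_def)
    qed (use 5(3) in \<open>auto simp: S_def\<close>)
    then obtain t6 s6 where 6: "exec (While (Var (M+2)) (Seq (Assign 0 (NodeE (Var (M+1)) (NodeE (LeftE (Var (M+2))) (Var 0))))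
      (Seq g (Assign (M+2) (RightE (Var (M+2))))))) s5 t6 s6"
      "t6 \<le> (1 + length (l x)) * (20 + 20 * S x + T x)" "s6 0 = ea (foldl (G x) (i x) (l x))"
      "\<And>i. i > M \<Longrightarrow> i \<noteq> M+2 \<Longrightarrow> s6 i = s5 i" by blast
    have ex: "exec C s ((1 + tree_size (e x)) + (t2 + ((1 + tree_size (enc_of_list eb (l x))) +
        ((1 + tree_size (e x)) + (t5 + t6))))) s6"
      unfolding C_def using 1 2(1) 3 4 5(1) 6(1) by (blast intro: exec.Seq)
    have "s6 i = s i" if "i > M + 2" for i
      using that 2(4)[of i] 5(4)[of i] 6(4)[of i] MK by (simp add: s4_def s3_def s1_def)
    moreover have "length (l x) \<le> S x"
      using length_le_tree_size[of "l x" eb] by (simp add: S_def)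
    then have "(1 + length (l x)) * (20 + 20 * S x + T x) \<le> (1 + S x) * (20 + 20 * S x + T x)"
      by (intro mult_mono) auto
    with 6(2) have "t6 \<le> (1 + S x) * (20 + 20 * S x + T x)" by linarith
    ultimately show "\<exists>t s'. exec C s t s' \<and> t \<le> B x \<and>
        s' 0 = ea (foldl (G x) (i x) (l x)) \<and> (\<forall>i>M+2. s' i = s i)"
      using ex 2(2) 5(2) 6(3) by (intro exI[of _ s6] exI conjI) (assumption, auto simp: S_def B_def)
  qed
  then show ?thesis
    by (rule ptimeI[OF _ B poly_bounded_mono[OF q]]) (use bound[of _ _ "[]"] in simp)
qed

section \<open>List operations and Boolean connectives\<close>

lemma ptime_Cons:
  assumes "ptime e a f" "ptime e (enc_of_list a) g"
  shows "ptime e (enc_of_list a) (\<lambda>x. f x # g x)"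
  by (rule ptime_reencode[OF ptime_Pair[OF assms]]) (simp add: enc_pair_def)

text \<open>Only the empty list is encoded as \<open>Leaf\<close>. Comparing the encoded trees
  themselves avoids asking for an injective element encoding.\<close>

lemma ptime_Nil_eq:
  assumes "ptime e (enc_of_list a) f"
  shows "ptime e tree_of_bool (\<lambda>x. f x = [])"
proof -
  have "ptime e id (\<lambda>x. enc_of_list a (f x))"
    by (rule ptime_reencode[OF assms]) simp
  from ptime_eq[OF _ this ptime_const[of e id Leaf]]
  have "ptime e tree_of_bool (\<lambda>x. enc_of_list a (f x) = Leaf)" by simp
  moreover have "enc_of_list a l = Leaf \<longleftrightarrow> l = []" for l by (cases l) auto
  ultimately show ?thesis by simp
qed

lemma ptime_tl:
  assumes "ptime e (enc_of_list a) f"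
  shows "ptime e (enc_of_list a) (\<lambda>x. tl (f x))"
proof -
  have "enc_of_list a (tl l) = right (enc_of_list a l)" for l by (cases l) auto
  then have "ptime (enc_of_list a) (enc_of_list a) tl" by (rule ptime_right)
  with assms show ?thesis by (rule ptime_comp)
qed

lemma ptime_not:
  assumes "ptime e tree_of_bool f"
  shows "ptime e tree_of_bool (\<lambda>x. \<not> f x)"
proof -
  have "ptime e tree_of_bool (\<lambda>x. if f x then False else True)"
    by (intro ptime_If assms ptime_const)
  then show ?thesis by (rule back_subst[of "ptime e tree_of_bool"]) auto
qed

lemma ptime_conj:
  assumes "ptime e tree_of_bool f" "ptime e tree_of_bool g"
  shows "ptime e tree_of_bool (\<lambda>x. f x \<and> g x)"
proof -
  have "ptime e tree_of_bool (\<lambda>x. if f x then g x else False)"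
    by (intro ptime_If assms ptime_const)
  then show ?thesis by (rule back_subst[of "ptime e tree_of_bool"]) auto
qed

lemma ptime_disj:
  assumes "ptime e tree_of_bool f" "ptime e tree_of_bool g"
  shows "ptime e tree_of_bool (\<lambda>x. f x \<or> g x)"
proof -
  have "ptime e tree_of_bool (\<lambda>x. if f x then True else g x)"
    by (intro ptime_If assms ptime_const)
  then show ?thesis by (rule back_subst[of "ptime e tree_of_bool"]) auto
qed

lemmas ptime_basic = ptime_const ptime_id ptime_fst ptime_snd ptime_Pair ptime_Cons ptime_Nil_eq
  ptime_tl ptime_not ptime_conj ptime_disj ptime_If

lemma tree_size_append:
  "tree_size (enc_of_list e (xs @ ys)) + 1 = tree_size (enc_of_list e xs) + tree_size (enc_of_list e ys)"
  by (induction xs) auto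

lemma tree_size_rev: "tree_size (enc_of_list e (rev xs)) = tree_size (enc_of_list e xs)"
proof (induction xs)
  case (Cons x xs)
  then show ?case using tree_size_append[of e "rev xs" "[x]"] by simp
qed simp

text \<open>A left fold with Cons reverses its list onto the start value; reversal and concatenation
  both follow from this one fold.\<close>

lemma ptime_rev_append:
  assumes "ptime e (enc_of_list a) f" "ptime e (enc_of_list a) g"
  shows "ptime e (enc_of_list a) (\<lambda>x. rev (f x) @ g x)"
proof -
  have eq: "foldl (\<lambda>acc b. b # acc) ys xs = rev xs @ ys" for xs ys :: "'b list"
    by (induction xs arbitrary: ys) auto
  have "ptime e (enc_of_list a) (\<lambda>x. foldl (\<lambda>acc b. b # acc) (g x) (f x))"
  proof (rule ptime_foldl[OF assms])
    show "poly_bounded e (\<lambda>x. tree_size (enc_of_list a (f x)) + tree_size (enc_of_list a (g x)))"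
      by (intro poly_bounded_intros ptime_size assms)
    fix x ys zs assume "f x = ys @ zs"
    then show "tree_size (enc_of_list a (foldl (\<lambda>acc b. b # acc) (g x) ys))
      \<le> tree_size (enc_of_list a (f x)) + tree_size (enc_of_list a (g x))"
      using tree_size_append[of a ys zs] tree_size_append[of a "rev ys" "g x"]
        tree_size_pos[of "enc_of_list a zs"] by (simp add: eq tree_size_rev)
  qed (rule ptime_basic)+
  then show ?thesis by (simp add: eq)
qed

lemma ptime_rev:
  assumes "ptime e (enc_of_list a) f"
  shows "ptime e (enc_of_list a) (\<lambda>x. rev (f x))"
  using ptime_rev_append[OF assms ptime_const[of _ _ "[]"]] by simp

lemma ptime_append:
  assumes "ptime e (enc_of_list a) f" "ptime e (enc_of_list a) g"
  shows "ptime e (enc_of_list a) (\<lambda>x. f x @ g x)"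
  using ptime_rev_append[OF ptime_rev[OF assms(1)] assms(2)] by simp

lemma ptime_filter:
  assumes l: "ptime e (enc_of_list a) l"
    and P: "ptime (enc_pair e a) tree_of_bool (\<lambda>z. P (fst z) (snd z))"
  shows "ptime e (enc_of_list a) (\<lambda>x. filter (P x) (l x))"
proof -
  have eq: "foldl (\<lambda>acc b. if Q b then b # acc else acc) ys xs = rev (filter Q xs) @ ys"
    for xs ys :: "'b list" and Q by (induction xs arbitrary: ys) auto
  have size: "tree_size (enc_of_list a (filter Q ys)) \<le> tree_size (enc_of_list a ys)" for Q ys
    by (induction ys) auto
  have "ptime e (enc_of_list a) (\<lambda>x. foldl (\<lambda>acc b. if P x b then b # acc else acc) [] (l x))"
  proof (rule ptime_foldl[OF l ptime_const])
    show "poly_bounded e (\<lambda>x. tree_size (enc_of_list a (l x)))" by (intro ptime_size l)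
    have P': "ptime (enc_pair e (enc_pair a (enc_of_list a))) tree_of_bool
      (\<lambda>z. P (fst z) (fst (snd z)))"
      using ptime_comp[OF ptime_Pair[OF ptime_fst[OF ptime_id] ptime_fst[OF ptime_snd[OF ptime_id]]] P]
      by simp
    show "ptime (enc_pair e (enc_pair a (enc_of_list a))) (enc_of_list a)
     (\<lambda>z. if P (fst z) (fst (snd z)) then fst (snd z) # snd (snd z) else snd (snd z))"
      by (rule P' ptime_basic)+
    fix x ys zs assume "l x = ys @ zs"
    then show "tree_size (enc_of_list a (foldl (\<lambda>acc b. if P x b then b # acc else acc) [] ys))
       \<le> tree_size (enc_of_list a (l x))"
      using tree_size_append[of a ys zs] size[of "P x" ys] tree_size_pos[of "enc_of_list a zs"]
      by (simp add: eq tree_size_rev)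
  qed
  from ptime_rev[OF this] show ?thesis by (simp add: eq)
qed

text \<open>The accumulator is bounded by the number of entries times a bound for one entry, which
  is polynomial because the output of \<open>g\<close> is polynomial in context and element.\<close>

lemma ptime_map:
  assumes l: "ptime e (enc_of_list a) l"
    and g: "ptime (enc_pair e a) b (\<lambda>z. g (fst z) (snd z))"
  shows "ptime e (enc_of_list b) (\<lambda>x. map (g x) (l x))"
proof -
  have eq: "foldl (\<lambda>acc y. h y # acc) ys xs = rev (map h xs) @ ys"
    for xs ys and h :: "'b \<Rightarrow> 'c" by (induction xs arbitrary: ys) auto
  obtain p where p: "\<And>z. tree_size (b (g (fst z) (snd z))) \<le> poly p (tree_size (enc_pair e a z))"
    using ptime_size[OF g] unfolding poly_bounded_def by blast
  define L where "L = (\<lambda>x. tree_size (enc_of_list a (l x)))"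
  have L: "poly_bounded e L" unfolding L_def by (intro ptime_size l)
  have "ptime e (enc_of_list b) (\<lambda>x. foldl (\<lambda>acc y. g x y # acc) [] (l x))"
  proof (rule ptime_foldl[OF l ptime_const])
    show "poly_bounded e (\<lambda>x. 1 + L x * (1 + poly p (tree_size (e x) + L x + 1)))"
      by (intro poly_bounded_intros L)
    have g': "ptime (enc_pair e (enc_pair a (enc_of_list b))) b (\<lambda>z. g (fst z) (fst (snd z)))"
      using ptime_comp[OF ptime_Pair[OF ptime_fst[OF ptime_id] ptime_fst[OF ptime_snd[OF ptime_id]]] g]
      by simp
    show "ptime (enc_pair e (enc_pair a (enc_of_list b))) (enc_of_list b)
     (\<lambda>z. g (fst z) (fst (snd z)) # snd (snd z))"
      by (rule g' ptime_basic)+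
    fix x ys zs assume xs: "l x = ys @ zs"
    show "tree_size (enc_of_list b (foldl (\<lambda>acc y. g x y # acc) [] ys))
       \<le> 1 + L x * (1 + poly p (tree_size (e x) + L x + 1))"
    proof (rule tree_size_enc_of_list_le)
      show "length (foldl (\<lambda>acc y. g x y # acc) [] ys) \<le> L x"
        using length_le_tree_size[of "l x" a] by (simp add: eq L_def xs)
      fix w assume "w \<in> set (foldl (\<lambda>acc y. g x y # acc) [] ys)"
      then obtain y where y: "y \<in> set (l x)" "w = g x y" by (auto simp: eq xs)
      have "tree_size (enc_pair e a (x, y)) \<le> tree_size (e x) + L x + 1"
        using tree_size_elem[OF y(1), of a] by (simp add: enc_pair_def L_def)
      then have "poly p (tree_size (enc_pair e a (x, y))) \<le> poly p (tree_size (e x) + L x + 1)"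
        by (rule poly_nat_mono)
      then show "tree_size (b w) \<le> poly p (tree_size (e x) + L x + 1)"
        using p[of "(x, y)"] y(2) by simp
    qed
  qed
  from ptime_rev[OF this] show ?thesis by (simp add: eq)
qed

lemma ptime_list_ex:
  assumes "ptime e (enc_of_list a) l" "ptime (enc_pair e a) tree_of_bool (\<lambda>z. P (fst z) (snd z))"
  shows "ptime e tree_of_bool (\<lambda>x. list_ex (P x) (l x))"
proof -
  have "list_ex Q xs \<longleftrightarrow> filter Q xs \<noteq> []" for Q :: "'b \<Rightarrow> bool" and xs
    by (auto simp: list_ex_iff filter_empty_conv)
  then show ?thesis using ptime_not[OF ptime_Nil_eq[OF ptime_filter[OF assms]]] by simp
qed

lemma ptime_list_all:
  assumes "ptime e (enc_of_list a) l" "ptime (enc_pair e a) tree_of_bool (\<lambda>z. P (fst z) (snd z))"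
  shows "ptime e tree_of_bool (\<lambda>x. list_all (P x) (l x))"
proof -
  have "list_all Q xs \<longleftrightarrow> \<not> list_ex (\<lambda>x. \<not> Q x) xs" for Q :: "'b \<Rightarrow> bool" and xs
    by (auto simp: list_ex_iff list_all_iff)
  then show ?thesis
    using ptime_not[OF ptime_list_ex[OF assms(1) ptime_not[OF assms(2)]]] by simp
qed

lemma ptime_member:
  assumes "ptime e (enc_of_list a) l" "ptime e a f" "inj a"
  shows "ptime e tree_of_bool (\<lambda>x. f x \<in> set (l x))"
proof -
  have "ptime e tree_of_bool (\<lambda>x. list_ex (\<lambda>y. f x = y) (l x))"
    by (rule ptime_list_ex[OF assms(1)] ptime_eq[OF assms(3)]
      ptime_comp[OF ptime_fst[OF ptime_id] assms(2)] ptime_snd ptime_id)+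
  then show ?thesis by (simp add: list_ex_iff)
qed

lemma ptime_concat:
  assumes l: "ptime e (enc_of_list (enc_of_list a)) l"
  shows "ptime e (enc_of_list a) (\<lambda>x. concat (l x))"
proof -
  have eq: "foldl (@) [] xs = concat xs" for xs :: "'b list list"
    by (induction xs rule: rev_induct) auto
  have size: "tree_size (enc_of_list a (concat xs)) \<le> tree_size (enc_of_list (enc_of_list a) xs)" for xs
  proof (induction xs)
    case (Cons y ys)
    then show ?case using tree_size_append[of a y "concat ys"] by simp
  qed simp
  have "ptime e (enc_of_list a) (\<lambda>x. foldl (@) [] (l x))"
  proof (rule ptime_foldl[OF l ptime_const])
    show "poly_bounded e (\<lambda>x. tree_size (enc_of_list (enc_of_list a) (l x)))" by (intro ptime_size l)
    fix x ys zs assume "l x = ys @ zs"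
    then show "tree_size (enc_of_list a (foldl (@) [] ys)) \<le> tree_size (enc_of_list (enc_of_list a) (l x))"
      using tree_size_append[of "enc_of_list a" ys zs] size[of ys]
        tree_size_pos[of "enc_of_list (enc_of_list a) zs"]
      unfolding eq by simp
  qed (rule ptime_append ptime_basic)+
  then show ?thesis unfolding eq .
qed

section \<open>Natural numbers in unary\<close>

text \<open>Unary is affordable for vertices and list lengths, which are at most linear in the size
  of the adjacency matrix, and a list of units can directly drive a fold as a loop counter.\<close>

definition enc_nat :: "nat \<Rightarrow> tree" where
  "enc_nat m = enc_of_list (\<lambda>_. Leaf) (replicate m ())"

lemma tree_size_enc_nat: "tree_size (enc_nat m) = 1 + 2 * m"
  unfolding enc_nat_def by (induction m) auto

lemma inj_enc_nat: "inj enc_nat"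
proof (rule injI)
  fix m m' assume "enc_nat m = enc_nat m'"
  then have "tree_size (enc_nat m) = tree_size (enc_nat m')" by (rule arg_cong)
  then show "m = m'" unfolding tree_size_enc_nat by simp
qed

lemma ptime_length:
  assumes l: "ptime e (enc_of_list a) l"
  shows "ptime e enc_nat (\<lambda>x. length (l x))"
proof -
  have "ptime e (enc_of_list (\<lambda>_. Leaf)) (\<lambda>x. map (\<lambda>_. ()) (l x))"
    by (rule ptime_map[OF l ptime_const])
  then show ?thesis
    by (rule ptime_reencode) (simp add: enc_nat_def map_replicate_const)
qed

lemma ptime_replicate_unit:
  assumes "ptime e enc_nat f"
  shows "ptime e (enc_of_list (\<lambda>_. Leaf)) (\<lambda>x. replicate (f x) ())"
  by (rule ptime_reencode[OF assms]) (simp add: enc_nat_def)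

lemma ptime_drop:
  assumes f: "ptime e enc_nat f" and l: "ptime e (enc_of_list a) l"
  shows "ptime e (enc_of_list a) (\<lambda>x. drop (f x) (l x))"
proof -
  have eq: "foldl (\<lambda>acc _. tl acc) xs us = drop (length us) xs" for xs :: "'b list" and us :: "unit list"
    by (induction us arbitrary: xs) (auto simp: drop_Suc)
  have "ptime e (enc_of_list a) (\<lambda>x. foldl (\<lambda>acc _. tl acc) (l x) (replicate (f x) ()))"
  proof (rule ptime_foldl[OF ptime_replicate_unit[OF f] l])
    show "poly_bounded e (\<lambda>x. tree_size (enc_of_list a (l x)))" by (intro ptime_size l)
    fix x and ys zs :: "unit list"
    show "tree_size (enc_of_list a (foldl (\<lambda>acc _. tl acc) (l x) ys)) \<le> tree_size (enc_of_list a (l x))"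
      using tree_size_append[of a "take (length ys) (l x)" "drop (length ys) (l x)"]
        tree_size_pos[of "enc_of_list a (take (length ys) (l x))"] by (simp add: eq)
  qed (rule ptime_basic)+
  then show ?thesis by (simp add: eq)
qed

text \<open>Since \<open>left Leaf = Leaf\<close>, reading past the end of a list yields
  \<open>Leaf\<close>; this is the right answer when the default value is encoded as
  \<open>Leaf\<close>.\<close>

lemma ptime_nth_default:
  assumes d: "a d = Leaf" and "ptime e (enc_of_list a) l" "ptime e enc_nat f"
  shows "ptime e a (\<lambda>x. nth_default d (l x) (f x))"
proof -
  have "a (nth_default d xs 0) = left (enc_of_list a xs)" for xs
    by (cases xs) (auto simp: d nth_default_def)
  then have "ptime (enc_of_list a) a (\<lambda>xs. nth_default d xs 0)" by (rule ptime_left)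
  with ptime_drop[OF assms(3,2)] have "ptime e a (\<lambda>x. nth_default d (drop (f x) (l x)) 0)"
    by (rule ptime_comp)
  then show ?thesis by (simp add: nth_default_def cong: if_cong)
qed

lemma ptime_upt:
  assumes f: "ptime e enc_nat f"
  shows "ptime e (enc_of_list enc_nat) (\<lambda>x. [0..<f x])"
proof -
  have eq: "foldl (\<lambda>acc _. acc @ [length acc]) [] us = [0..<length us]" for us :: "unit list"
    by (induction us rule: rev_induct) auto
  have "ptime e (enc_of_list enc_nat) (\<lambda>x. foldl (\<lambda>acc _. acc @ [length acc]) [] (replicate (f x) ()))"
  proof (rule ptime_foldl[OF ptime_replicate_unit[OF f] ptime_const])
    let ?s = "\<lambda>x. tree_size (enc_nat (f x))"
    show "poly_bounded e (\<lambda>x. 1 + ?s x * (1 + ?s x))"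
      by (intro poly_bounded_intros ptime_size f)
    fix x and ys zs :: "unit list"
    assume "replicate (f x) () = ys @ zs"
    then have "length ys \<le> f x" by (metis length_append length_replicate le_add1)
    then show "tree_size (enc_of_list enc_nat (foldl (\<lambda>acc _. acc @ [length acc]) [] ys)) \<le> 1 + ?s x * (1 + ?s x)"
      unfolding eq by (intro tree_size_enc_of_list_le) (auto simp: tree_size_enc_nat)
  qed (rule ptime_basic ptime_append ptime_length)+
  then show ?thesis by (simp add: eq)
qed

lemmas ptime_intros = ptime_basic ptime_append ptime_rev ptime_filter ptime_map ptime_concat
  ptime_length ptime_upt ptime_list_ex ptime_list_all ptime_member[OF _ _ inj_enc_nat]

lemma ptime_app2:
  assumes "ptime (enc_pair a b) c (\<lambda>z. F (fst z) (snd z))" "ptime e a f" "ptime e b g"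
  shows "ptime e c (\<lambda>x. F (f x) (g x))"
  using ptime_comp[OF ptime_Pair[OF assms(2,3)] assms(1)] by simp

lemma ptime_app3:
  assumes "ptime (enc_pair a (enc_pair b c)) d (\<lambda>z. F (fst z) (fst (snd z)) (snd (snd z)))"
    "ptime e a f" "ptime e b g" "ptime e c h"
  shows "ptime e d (\<lambda>x. F (f x) (g x) (h x))"
  using ptime_comp[OF ptime_Pair[OF assms(2) ptime_Pair[OF assms(3,4)]] assms(1)] by simp

lemma ptime_Suc:
  assumes "ptime e enc_nat f"
  shows "ptime e enc_nat (\<lambda>x. Suc (f x))"
  by (rule ptime_reencode[OF ptime_Pair[OF ptime_const[of e "\<lambda>_::unit. Leaf"] assms]])
    (simp add: enc_pair_def enc_nat_def)

section \<open>Comparison with a number in binary\<close>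

fun inc :: "bool list \<Rightarrow> bool list" where
  "inc [] = [True]"
| "inc (b # bs) = (if b then False # inc bs else True # bs)"

lemma inc_bits_of_nat: "inc (bits_of_nat n) = bits_of_nat (Suc n)"
proof (induction n rule: less_induct)
  case (less n)
  show ?case
  proof (cases "n = 0")
    case True
    then show ?thesis by (simp add: bits_of_nat.simps[of 0] bits_of_nat.simps[of "Suc 0"])
  next
    case False
    have "bits_of_nat n = odd n # bits_of_nat (n div 2)"
      "bits_of_nat (Suc n) = even n # bits_of_nat (Suc n div 2)"
      using False by (simp_all add: bits_of_nat.simps[of n] bits_of_nat.simps[of "Suc n"])
    moreover have "n div 2 < n" using False by simp
    moreover have "odd n \<Longrightarrow> Suc n div 2 = Suc (n div 2)" "even n \<Longrightarrow> Suc n div 2 = n div 2" by auto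
    ultimately show ?thesis using less.IH[of "n div 2"] by auto
  qed
qed

lemma length_inc: "length (inc bs) \<le> Suc (length bs)"
  by (induction bs) auto

text \<open>Carry propagation is recast as a left fold whose state holds the carry and the output
  bits in reverse; a carry left at the end becomes the new top bit.\<close>

lemma ptime_inc:
  assumes f: "ptime e (enc_of_list tree_of_bool) f"
  shows "ptime e (enc_of_list tree_of_bool) (\<lambda>x. inc (f x))"
proof -
  define G :: "bool \<times> bool list \<Rightarrow> bool \<Rightarrow> bool \<times> bool list"
    where "G = (\<lambda>s b. (fst s \<and> b, (b \<noteq> fst s) # snd s))"
  define F where "F = (\<lambda>bs. foldl G (True, []) bs)"
  \<comment> \<open>Once the carry is gone, the remaining bits are merely copied.\<close>
  have F0: "foldl G (False, out) bs = (False, rev bs @ out)" for out bs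
    by (induction bs arbitrary: out) (auto simp: G_def)
  have eq: "inc bs = rev (if fst (F bs) then True # snd (F bs) else snd (F bs))" for bs
  proof -
    have "rev out @ inc bs = rev (if fst (foldl G (True, out) bs)
        then True # snd (foldl G (True, out) bs) else snd (foldl G (True, out) bs))" for out
    proof (induction bs arbitrary: out)
      case (Cons b bs)
      show ?case
        using Cons.IH[of "False # out"] F0[of "True # out" bs] by (cases b) (simp_all add: G_def)
    qed simp
    from this[of "[]"] show ?thesis by (simp add: F_def)
  qed
  have len: "length (snd (foldl G s bs)) = length (snd s) + length bs" for s bs
    by (induction bs arbitrary: s) (auto simp: G_def)
  have F: "ptime e (enc_pair tree_of_bool (enc_of_list tree_of_bool)) (\<lambda>x. F (f x))"
    unfolding F_def
  proof (rule ptime_foldl[OF f ptime_const])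
    let ?s = "\<lambda>x. tree_size (enc_of_list tree_of_bool (f x))"
    show "poly_bounded e (\<lambda>x. 4 + (1 + ?s x * (1 + 3)))"
      by (intro poly_bounded_intros ptime_size f)
    fix x ys zs assume "f x = ys @ zs"
    then have "length ys \<le> ?s x" using length_le_tree_size[of "f x" tree_of_bool] by simp
    then have "tree_size (enc_of_list tree_of_bool (snd (foldl G (True, []) ys))) \<le> 1 + ?s x * (1 + 3)"
      by (intro tree_size_enc_of_list_le) (auto simp: len tree_of_bool_def)
    then show "tree_size (enc_pair tree_of_bool (enc_of_list tree_of_bool) (foldl G (True, []) ys))
       \<le> 4 + (1 + ?s x * (1 + 3))"
      by (simp add: enc_pair_def tree_of_bool_def)
  qed (unfold G_def, (rule ptime_basic ptime_eq[OF inj_tree_of_bool])+)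
  show ?thesis
    unfolding eq by (rule F ptime_rev ptime_basic)+
qed

text \<open>A binary counter advances once per list element and is compared with \<open>bs\<close>
  each time. The cost depends on the lengths of \<open>xs\<close> and \<open>bs\<close>, not on the
  number encoded by \<open>bs\<close>, which may be exponential in its length.\<close>

definition at_least :: "'a list \<Rightarrow> bool list \<Rightarrow> bool" where
  "at_least xs bs = snd (foldl (\<lambda>s _. (inc (fst s), snd s \<or> inc (fst s) = bs)) ([], False) xs)"

text \<open>The counter is compared only after being incremented, so it is tested at the values from
  1 to \<open>length xs\<close>; hence the assumption that \<open>k\<close> is positive. Binary
  representations are unique, so the comparison succeeds exactly at \<open>k\<close>.\<close>

lemma at_least_iff:
  assumes "k \<ge> 1"
  shows "at_least xs (bits_of_nat k) \<longleftrightarrow> k \<le> length xs"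
proof -
  have inj: "bits_of_nat m = bits_of_nat m' \<longleftrightarrow> m = m'" for m m'
  proof (induction m arbitrary: m' rule: less_induct)
    case (less m)
    show ?case
    proof (cases "m = 0 \<or> m' = 0")
      case True
      then show ?thesis by (auto simp: bits_of_nat.simps[of m] bits_of_nat.simps[of m'])
    next
      case False
      then have "bits_of_nat m = bits_of_nat m' \<longleftrightarrow> odd m = odd m' \<and> m div 2 = m' div 2"
        using less.IH[of "m div 2" "m' div 2"]
        by (simp add: bits_of_nat.simps[of m] bits_of_nat.simps[of m'])
      also have "\<dots> \<longleftrightarrow> m = m'" by (metis dvd_mult_div_cancel odd_two_times_div_two_succ)
      finally show ?thesis .
    qed
  qed
  have "foldl (\<lambda>s _. (inc (fst s), snd s \<or> inc (fst s) = bits_of_nat k)) ([], False) xs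
    = (bits_of_nat (length xs), k \<le> length xs)"
    using assms by (induction xs rule: rev_induct)
      (auto simp: inc_bits_of_nat inj bits_of_nat.simps[of 0])
  then show ?thesis by (simp add: at_least_def)
qed

lemma ptime_at_least:
  assumes l: "ptime e (enc_of_list a) l" and k: "ptime e (enc_of_list tree_of_bool) k"
  shows "ptime e tree_of_bool (\<lambda>x. at_least (l x) (k x))"
proof -
  let ?B = "enc_of_list tree_of_bool"
  define G :: "bool list \<Rightarrow> bool list \<times> bool \<Rightarrow> 'b \<Rightarrow> bool list \<times> bool"
    where "G = (\<lambda>bs s _. (inc (fst s), snd s \<or> inc (fst s) = bs))"
  have len: "length (fst (foldl (G bs) s xs)) \<le> length (fst s) + length xs" for bs s xs
  proof (induction xs arbitrary: s)
    case (Cons x xs)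
    show ?case using Cons.IH[of "G bs s x"] length_inc[of "fst s"] by (simp add: G_def)
  qed simp
  have "ptime (enc_pair (enc_of_list a) ?B) (enc_pair ?B tree_of_bool)
     (\<lambda>z. foldl (G (snd z)) ([], False) (fst z))"
  proof (rule ptime_foldl[OF ptime_fst[OF ptime_id] ptime_const])
    let ?s = "\<lambda>z. tree_size (enc_pair (enc_of_list a) ?B z)"
    show "poly_bounded (enc_pair (enc_of_list a) ?B) (\<lambda>z. 1 + ?s z * (1 + 3) + 4)"
      by (intro poly_bounded_intros)
    fix z :: "'b list \<times> bool list" and ys zs assume z: "fst z = ys @ zs"
    have "length ys \<le> ?s z"
      using length_le_tree_size[of "fst z" a] z by (simp add: enc_pair_def)
    then have "tree_size (?B (fst (foldl (G (snd z)) ([], False) ys))) \<le> 1 + ?s z * (1 + 3)"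
      using len[of "snd z" "([], False)" ys]
      by (intro tree_size_enc_of_list_le) (auto simp: tree_of_bool_def)
    then show "tree_size (enc_pair ?B tree_of_bool (foldl (G (snd z)) ([], False) ys)) \<le> 1 + ?s z * (1 + 3) + 4"
      by (simp add: enc_pair_def[of ?B] tree_of_bool_def)
  qed (unfold G_def, (rule ptime_basic ptime_inc ptime_eq[OF inj_enc_of_list[OF inj_tree_of_bool]])+)
  from ptime_snd[OF this] show ?thesis
    by (intro ptime_app2[OF _ l k]) (simp add: at_least_def G_def)
qed

section \<open>The algorithm\<close>

definition adj :: "bool list list \<Rightarrow> nat \<Rightarrow> nat \<Rightarrow> bool" where
  "adj M u v = nth_default False (nth_default [] M u) v"

text \<open>A greedily built maximal independent set of \<open>R\<close>.\<close>

definition mis :: "bool list list \<Rightarrow> nat list \<Rightarrow> nat list" where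
  "mis M R = foldl (\<lambda>I v. if list_ex (adj M v) I then I else v # I) [] R"

definition peel :: "bool list list \<Rightarrow> nat list \<times> nat list list \<Rightarrow> nat list \<times> nat list list" where
  "peel M s = (if fst s = [] then s
     else (filter (\<lambda>v. v \<notin> set (mis M (fst s))) (fst s), mis M (fst s) # snd s))"

text \<open>The second list only counts rounds. Each \<open>peel\<close> removes a vertex while any
  is left and is idle afterwards, so as many rounds as vertices suffice.\<close>

definition classes :: "bool list list \<Rightarrow> nat list list" where
  "classes M = snd (foldl (\<lambda>s _. peel M s) ([0..<length M], []) [0..<length M])"

text \<open>Bucket sort by decreasing degree into \<open>B\<close>.\<close>

definition by_degree :: "bool list list \<Rightarrow> nat list \<Rightarrow> nat list \<Rightarrow> nat list" where
  "by_degree M A B = concat (map (\<lambda>d. filter (\<lambda>x. length (filter (adj M x) B) = d) A)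
     (rev [0..<Suc (length B)]))"

definition candidates :: "bool list list \<Rightarrow> nat list \<Rightarrow> nat list \<Rightarrow> nat \<Rightarrow> nat \<Rightarrow> nat list" where
  "candidates M B U x w = filter (\<lambda>y. adj M w y \<and> \<not> adj M x y \<and> y \<notin> set U) B"

text \<open>The default 0 is never selected, because the test guarantees that all candidate lists
  are nonempty. Several centers may choose the same vertex; this is harmless since all chosen
  vertices get the same color.\<close>

definition try_center ::
    "bool list list \<Rightarrow> nat list \<Rightarrow> nat list \<times> nat list \<Rightarrow> nat \<Rightarrow> nat list \<times> nat list" where
  "try_center M B s x =
     (if list_all (\<lambda>w. candidates M B (snd s) x w \<noteq> []) (fst s)
      then (x # fst s, map (\<lambda>w. nth_default 0 (candidates M B (snd s) x w) 0) (fst s) @ snd s)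
      else s)"

definition centers :: "bool list list \<Rightarrow> nat list \<Rightarrow> nat list \<Rightarrow> nat list \<times> nat list" where
  "centers M A B = foldl (try_center M B) ([], []) (by_degree M A B)"

definition right_side :: "bool list list \<Rightarrow> nat list \<Rightarrow> nat list \<Rightarrow> nat \<Rightarrow> nat list" where
  "right_side M B U w = filter (\<lambda>y. adj M w y \<and> y \<notin> set U) B"

text \<open>Each biclique is produced as the characteristic vector of its vertex set, the form in
  which it is output. The left side is the set of all common neighbors in \<open>A\<close> of the
  right side; centers with empty right side are dropped since both sides of a biclique must be
  nonempty.\<close>

definition bicliques :: "bool list list \<Rightarrow> nat list \<Rightarrow> nat list \<Rightarrow> bool list list" where
  "bicliques M A B =
     map (\<lambda>w. map (\<lambda>v. v \<in> set (right_side M B (snd (centers M A B)) w) \<or>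
               v \<in> set A \<and> list_all (adj M v) (right_side M B (snd (centers M A B)) w)) [0..<length M])
       (filter (\<lambda>w. right_side M B (snd (centers M A B)) w \<noteq> []) (fst (centers M A B)))"

definition enough :: "bool list list \<Rightarrow> bool list \<Rightarrow> bool" where
  "enough M bs \<longleftrightarrow> at_least (classes M) bs \<or>
     list_ex (\<lambda>A. list_ex (\<lambda>B. at_least (fst (centers M A B)) bs) (classes M)) (classes M)"

definition all_bicliques :: "bool list list \<Rightarrow> bool list list" where
  "all_bicliques M = concat (map (\<lambda>A. concat (map (bicliques M A) (classes M))) (classes M))"

abbreviation "enc_matrix \<equiv> enc_of_list (enc_of_list tree_of_bool)"
abbreviation "enc_nats \<equiv> enc_of_list enc_nat"

section \<open>Polynomial running time of the algorithm\<close>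

lemma ptime_adj:
  assumes "ptime e enc_matrix m" "ptime e enc_nat f" "ptime e enc_nat g"
  shows "ptime e tree_of_bool (\<lambda>x. adj (m x) (f x) (g x))"
  unfolding adj_def
  by (rule ptime_nth_default, simp add: tree_of_bool_def, rule ptime_nth_default) (simp | rule assms)+

lemma tree_size_foldl_mis:
  "tree_size (enc_nats (foldl (\<lambda>I v. if list_ex (adj M v) I then I else v # I) I R)) + 1
     \<le> tree_size (enc_nats I) + tree_size (enc_nats R)"
proof (induction R arbitrary: I)
  case (Cons v R)
  show ?case
    using Cons.IH[of I] Cons.IH[of "v # I"] by auto
qed simp

lemma tree_size_mis: "tree_size (enc_nats (mis M R)) \<le> tree_size (enc_nats R)"
  using tree_size_foldl_mis[of M "[]" R] by (simp add: mis_def)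

lemma ptime_mis:
  assumes "ptime e enc_matrix m" "ptime e enc_nats f"
  shows "ptime e enc_nats (\<lambda>x. mis (m x) (f x))"
proof (rule ptime_app2[OF _ assms])
  let ?e = "enc_pair enc_matrix enc_nats"
  show "ptime ?e enc_nats (\<lambda>z. mis (fst z) (snd z))"
    unfolding mis_def
  proof (rule ptime_foldl[OF ptime_snd[OF ptime_id] ptime_const])
    show "poly_bounded ?e (\<lambda>z. tree_size (?e z))" by (rule poly_bounded_intros)
    fix z :: "bool list list \<times> nat list" and ys zs assume z: "snd z = ys @ zs"
    then show "tree_size (enc_nats (foldl (\<lambda>I v. if list_ex (adj (fst z) v) I then I else v # I) [] ys))
      \<le> tree_size (?e z)"
      using tree_size_foldl_mis[of "fst z" "[]" ys] tree_size_append[of enc_nat ys zs]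
        tree_size_pos[of "enc_nats zs"] by (simp add: enc_pair_def)
  qed (rule ptime_adj ptime_intros)+
qed

text \<open>The list of remaining vertices never grows, a class is no larger than the list it is
  taken from, and each round adds at most one class. So the state is at most quadratic in the size
  of the vertex list.\<close>

lemma ptime_classes:
  assumes "ptime e enc_matrix m"
  shows "ptime e (enc_of_list enc_nats) (\<lambda>x. classes (m x))"
proof (rule ptime_comp[OF assms])
  let ?e = "enc_pair enc_nats (enc_of_list enc_nats)"
  let ?V = "\<lambda>M :: bool list list. [0..<length M]"
  let ?s = "\<lambda>M. tree_size (enc_nats (?V M))"
  have V: "ptime enc_matrix enc_nats ?V" by (rule ptime_intros)+
  have inv: "tree_size (enc_nats (fst (foldl (\<lambda>s _. peel M s) (R, []) xs))) \<le> tree_size (enc_nats R) \<and>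
      length (snd (foldl (\<lambda>s _. peel M s) (R, []) xs)) \<le> length xs \<and>
      (\<forall>C \<in> set (snd (foldl (\<lambda>s _. peel M s) (R, []) xs)). tree_size (enc_nats C) \<le> tree_size (enc_nats R))"
    for M R and xs :: "nat list"
  proof (induction xs rule: rev_induct)
    case (snoc x xs)
    have filter: "tree_size (enc_nats (filter Q ys)) \<le> tree_size (enc_nats ys)" for Q ys
      by (induction ys) auto
    define s where "s = foldl (\<lambda>s _. peel M s) (R, []) xs"
    have s: "foldl (\<lambda>s _. peel M s) (R, []) (xs @ [x]) = peel M s" by (simp add: s_def)
    show ?case
      using snoc tree_size_mis[of M "fst s"] filter[of "\<lambda>v. v \<notin> set (mis M (fst s))" "fst s"]
      unfolding s s_def[symmetric] by (auto simp: peel_def)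
  qed simp
  have "ptime enc_matrix ?e (\<lambda>M. foldl (\<lambda>s _. peel M s) (?V M, []) (?V M))"
  proof (rule ptime_foldl[OF V])
    show "poly_bounded enc_matrix (\<lambda>M. 1 + ?s M + (1 + ?s M * (1 + ?s M)))"
      by (intro poly_bounded_intros ptime_size V)
    fix M ys zs assume V: "?V M = ys @ zs"
    then have "length ys \<le> length (?V M)" by simp
    also have "\<dots> \<le> ?s M" by (rule length_le_tree_size)
    finally have "length ys \<le> ?s M" .
    then have "tree_size (enc_of_list enc_nats (snd (foldl (\<lambda>s _. peel M s) (?V M, []) ys))) \<le> 1 + ?s M * (1 + ?s M)"
      using inv[of M "?V M" ys] by (intro tree_size_enc_of_list_le) auto
    then show "tree_size (?e (foldl (\<lambda>s _. peel M s) (?V M, []) ys)) \<le> 1 + ?s M + (1 + ?s M * (1 + ?s M))"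
      using inv[of M "?V M" ys] by (simp add: enc_pair_def)
  next
    show "ptime enc_matrix ?e (\<lambda>M. (?V M, []))" by (rule ptime_intros)+
    show "ptime (enc_pair enc_matrix (enc_pair enc_nat ?e)) ?e (\<lambda>z. peel (fst z) (snd (snd z)))"
      unfolding peel_def by (rule ptime_mis ptime_intros)+
  qed
  then show "ptime enc_matrix (enc_of_list enc_nats) classes"
    unfolding classes_def[abs_def] by (rule ptime_snd)
qed

text \<open>Each scanned vertex adds at most one center and at most one new vertex per earlier
  center, so the two lists have at most linear and quadratic length in the number of scanned
  vertices.\<close>

lemma ptime_centers:
  assumes "ptime e enc_matrix m" "ptime e enc_nats f" "ptime e enc_nats g"
  shows "ptime e (enc_pair enc_nats enc_nats) (\<lambda>x. centers (m x) (f x) (g x))"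
proof (rule ptime_app3[OF _ assms])
  let ?e = "enc_pair enc_matrix (enc_pair enc_nats enc_nats)"
  let ?l = "\<lambda>z. by_degree (fst z) (fst (snd z)) (snd (snd z))"
  define T where "T = (\<lambda>z. tree_size (enc_nats (?l z)) + tree_size (enc_nats (snd (snd z))))"
  have l: "ptime ?e enc_nats ?l"
    unfolding by_degree_def by (rule ptime_adj ptime_intros ptime_Suc ptime_eq[OF inj_enc_nat])+
  have T: "poly_bounded ?e T"
    unfolding T_def by (intro poly_bounded_intros ptime_size l) (rule ptime_intros)+
  have inv: "length (fst (foldl (try_center M B) ([], []) xs)) \<le> length xs \<and>
      set (fst (foldl (try_center M B) ([], []) xs)) \<subseteq> set xs \<and>
      length (snd (foldl (try_center M B) ([], []) xs)) \<le> length xs * length xs \<and>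
      set (snd (foldl (try_center M B) ([], []) xs)) \<subseteq> insert 0 (set B)" for M B xs
  proof (induction xs rule: rev_induct)
    case (snoc x xs)
    define s where "s = foldl (try_center M B) ([], []) xs"
    have s: "foldl (try_center M B) ([], []) (xs @ [x]) = try_center M B s x" by (simp add: s_def)
    have "nth_default 0 (candidates M B U x w) 0 \<in> insert 0 (set B)" for U w
      by (auto simp: nth_default_def candidates_def dest: nth_mem)
        (metis filter_is_subset length_greater_0_conv nth_mem subsetD)
    then have "set (map (\<lambda>w. nth_default 0 (candidates M B (snd s) x w) 0) (fst s)) \<subseteq> insert 0 (set B)"
      by (auto simp del: insert_iff)
    with snoc[folded s_def] show ?case
      unfolding s unfolding try_center_def by (auto simp del: insert_iff)
  qed simp
  show "ptime ?e (enc_pair enc_nats enc_nats) (\<lambda>z. centers (fst z) (fst (snd z)) (snd (snd z)))"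
    unfolding centers_def
  proof (rule ptime_foldl[OF l ptime_const])
    show "poly_bounded ?e (\<lambda>z. 1 + (1 + T z * (1 + T z)) + (1 + (T z * T z) * (1 + T z)))"
      by (intro poly_bounded_intros T)
    show "ptime (enc_pair ?e (enc_pair enc_nat (enc_pair enc_nats enc_nats))) (enc_pair enc_nats enc_nats)
      (\<lambda>z. try_center (fst (fst z)) (snd (snd (fst z))) (snd (snd z)) (fst (snd z)))"
      unfolding try_center_def candidates_def
      by ((rule ptime_adj ptime_nth_default ptime_intros) | simp add: enc_nat_def)+
    fix z ys zs assume z: "?l z = ys @ zs"
    let ?s = "foldl (try_center (fst z) (snd (snd z))) ([], []) ys"
    note inv = inv[of "fst z" "snd (snd z)" ys]
    have len: "length ys \<le> T z" using length_le_tree_size[of "?l z" enc_nat] z by (simp add: T_def)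
    have "tree_size (enc_nats (fst ?s)) \<le> 1 + T z * (1 + T z)"
    proof (rule tree_size_enc_of_list_le)
      show "length (fst ?s) \<le> T z" using inv len by linarith
      fix x assume "x \<in> set (fst ?s)"
      then have "x \<in> set (?l z)" using inv z by auto
      then show "tree_size (enc_nat x) \<le> T z"
        using tree_size_elem[of x "?l z" enc_nat] by (simp add: T_def)
    qed
    moreover have "tree_size (enc_nats (snd ?s)) \<le> 1 + (T z * T z) * (1 + T z)"
    proof (rule tree_size_enc_of_list_le)
      show "length (snd ?s) \<le> T z * T z" using inv mult_le_mono[OF len len] by linarith
      fix x assume "x \<in> set (snd ?s)"
      then have "x = 0 \<or> x \<in> set (snd (snd z))" using inv by auto
      then show "tree_size (enc_nat x) \<le> T z"
        using tree_size_elem[of x "snd (snd z)" enc_nat] tree_size_pos[of "enc_nats (snd (snd z))"]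
        by (auto simp: T_def tree_size_enc_nat simp del: tree_size_pos)
    qed
    ultimately show "tree_size (enc_pair enc_nats enc_nats ?s)
      \<le> 1 + (1 + T z * (1 + T z)) + (1 + (T z * T z) * (1 + T z))"
      by (simp add: enc_pair_def)
  qed
qed

lemma ptime_bicliques:
  assumes "ptime e enc_matrix m" "ptime e enc_nats f" "ptime e enc_nats g"
  shows "ptime e enc_matrix (\<lambda>x. bicliques (m x) (f x) (g x))"
  by (rule ptime_app3[OF _ assms], unfold bicliques_def right_side_def)
    (rule ptime_adj ptime_centers ptime_intros)+

lemma ptime_enough:
  "ptime (enc_pair enc_matrix (enc_of_list tree_of_bool)) tree_of_bool (\<lambda>z. enough (fst z) (snd z))"
  unfolding enough_def by (rule ptime_at_least ptime_classes ptime_centers ptime_intros)+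

lemma ptime_all_bicliques:
  assumes "ptime e enc_matrix m"
  shows "ptime e enc_matrix (\<lambda>x. all_bicliques (m x))"
  by (rule ptime_comp[OF assms], unfold all_bicliques_def)
    (rule ptime_classes ptime_bicliques ptime_intros)+

text \<open>The result is a raw tree, with \<open>id\<close> as its encoding:
  \<open>enc_answer\<close> depends on the number of vertices, which varies with the input, whereas
  \<open>ptime\<close> fixes one output encoding.\<close>

lemma ptime_answer:
  "ptime (enc_pair enc_matrix (enc_of_list tree_of_bool)) id
     (\<lambda>z. if enough (fst z) (snd z) then Leaf else Node Leaf (enc_matrix (all_bicliques (fst z))))"
proof (rule ptime_If[OF ptime_enough ptime_const])
  show "ptime (enc_pair enc_matrix (enc_of_list tree_of_bool)) id
     (\<lambda>z. Node Leaf (enc_matrix (all_bicliques (fst z))))"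
    by (rule ptime_reencode[OF ptime_Pair[OF ptime_const[of _ id Leaf]
       ptime_all_bicliques[OF ptime_fst[OF ptime_id]]]]) (simp add: enc_pair_def)
qed

section \<open>Extending a partial Grundy coloring of an induced subgraph\<close>

definition grundy_on :: "'a ugraph \<Rightarrow> 'a set \<Rightarrow> nat \<Rightarrow> ('a \<Rightarrow> nat) \<Rightarrow> bool" where
  "grundy_on G S m c \<longleftrightarrow> S \<subseteq> verts G \<and> c ` S \<subseteq> {1..m} \<and>
     (\<forall>u\<in>S. \<forall>v\<in>S. {u, v} \<in> edges G \<longrightarrow> c u \<noteq> c v) \<and>
     (\<forall>i\<in>{1..m}. \<exists>v\<in>S. c v = i \<and> (\<forall>j\<in>{1..<i}. \<exists>u\<in>S. {v, u} \<in> edges G \<and> c u = j))"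

lemma loop_free: "finite_simple_graph G \<Longrightarrow> {v, v} \<notin> edges G"
  by (auto simp: finite_simple_graph_def)

text \<open>The vertex \<open>v\<close> receives the least color missing among its neighbors in
  \<open>S\<close>. If this color is at most \<open>m\<close>, the old witnesses suffice; otherwise
  it is \<open>m + 1\<close> and \<open>v\<close> itself is the witness, as it sees all smaller
  colors.\<close>

lemma grundy_on_insert:
  assumes G: "finite_simple_graph G" and S: "grundy_on G S m c" and v: "v \<in> verts G - S"
  shows "\<exists>m' c'. m \<le> m' \<and> grundy_on G (insert v S) m' c'"
proof -
  define P where "P = (\<lambda>i. 1 \<le> i \<and> (\<forall>u\<in>S. {v, u} \<in> edges G \<longrightarrow> c u \<noteq> i))"
  define a where "a = (LEAST i. P i)"
  \<comment> \<open>Color \<open>m + 1\<close> is always free, so the least free color exists and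
    exceeds \<open>m\<close> by at most one.\<close>
  have Pm: "P (m + 1)" using S by (fastforce simp: P_def grundy_on_def)
  have Pa: "P a" unfolding a_def by (rule LeastI[of P, OF Pm])
  have am: "a \<le> m + 1" unfolding a_def by (rule Least_le[of P, OF Pm])
  have less: "\<exists>u\<in>S. {v, u} \<in> edges G \<and> c u = j" if "j \<in> {1..<a}" for j
    using not_less_Least[of j P] that by (auto simp: a_def P_def)
  define c' where "c' = c(v := a)"
  have c': "c' v = a" "\<And>u. u \<in> S \<Longrightarrow> c' u = c u" using v by (auto simp: c'_def)
  have "grundy_on G (insert v S) (max m a) c'"
    unfolding grundy_on_def
  proof (intro conjI ballI impI)
    show "insert v S \<subseteq> verts G" using S v by (auto simp: grundy_on_def)
    show "c' ` insert v S \<subseteq> {1..max m a}"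
      using S Pa c' by (fastforce simp: grundy_on_def P_def)
  next
    fix u w assume "u \<in> insert v S" "w \<in> insert v S" "{u, w} \<in> edges G"
    then show "c' u \<noteq> c' w"
      using S Pa c' loop_free[OF G, of v]
      by (cases "u = v"; cases "w = v") (auto simp: grundy_on_def P_def insert_commute)
  next
    fix i assume i: "i \<in> {1..max m a}"
    show "\<exists>w\<in>insert v S. c' w = i \<and> (\<forall>j\<in>{1..<i}. \<exists>u\<in>insert v S. {w, u} \<in> edges G \<and> c' u = j)"
    proof (cases "i \<le> m")
      case True
      then have "i \<in> {1..m}" using i by simp
      then obtain w where "w \<in> S" "c w = i" "\<forall>j\<in>{1..<i}. \<exists>u\<in>S. {w, u} \<in> edges G \<and> c u = j"
        using S unfolding grundy_on_def by blast
      then show ?thesis using c' by (metis insertCI)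
    next
      case False
      then have "i = a" using i am by auto
      then show ?thesis using c' less by (metis insertCI)
    qed
  qed
  then show ?thesis by (intro exI[of _ "max m a"] exI[of _ c']) simp
qed

text \<open>The uncolored vertices are added one at a time, which never lowers the number of colors.
  Thus a coloring of some induced subgraph is enough for a lower bound on the whole graph.\<close>

lemma grundy_on_imp_has_partial_Grundy:
  assumes G: "finite_simple_graph G" and "grundy_on G S m c" and "k \<le> m"
  shows "has_partial_Grundy_coloring_with_at_least G k"
  using assms(2,3)
proof (induction "card (verts G - S)" arbitrary: S m c rule: less_induct)
  case less
  have fin: "finite (verts G)" using G by (simp add: finite_simple_graph_def)
  show ?case
  proof (cases "verts G - S = {}")
    case True
    then have "S = verts G" using less.prems(1) by (auto simp: grundy_on_def)
    with less.prems(1) have "grundy_on G (verts G) m c" by simp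
    then have "partial_Grundy_coloring G m c"
      unfolding grundy_on_def partial_Grundy_coloring_def proper_coloring_def neighbors_def
      by (fast intro: CollectI)
    then show ?thesis
      using less.prems(2) unfolding has_partial_Grundy_coloring_with_at_least_def by blast
  next
    case False
    then obtain v where v: "v \<in> verts G - S" by blast
    from grundy_on_insert[OF G less.prems(1) v] obtain m' c' where
      m': "m \<le> m'" "grundy_on G (insert v S) m' c'" by blast
    have "card (verts G - insert v S) < card (verts G - S)"
      using v fin by (intro psubset_card_mono) auto
    from less.hyps[OF this m'(2)] show ?thesis using less.prems(2) m'(1) by simp
  qed
qed

section \<open>Correctness\<close>

lemma length_concat_le: "(\<And>xs. xs \<in> set xss \<Longrightarrow> length xs \<le> b) \<Longrightarrow> length (concat xss) \<le> length xss * b"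
proof (induction xss)
  case (Cons xs xss)
  from Cons.IH Cons.prems have "length (concat xss) \<le> length xss * b" "length xs \<le> b" by auto
  then show ?case by simp
qed simp

locale graph_instance =
  fixes G :: "nat ugraph" and n :: nat and M :: "bool list list"
  assumes simple: "finite_simple_graph G" and verts_G: "verts G = {..<n}"
    and M_eq: "M = map (\<lambda>v. map (\<lambda>u. u \<in> neighbors G v) [0..<n]) [0..<n]"
begin

lemma length_M [simp]: "length M = n"
  by (simp add: M_eq)

lemma edge_less: "{u, v} \<in> edges G \<Longrightarrow> u < n \<and> v < n"
  using simple verts_G unfolding finite_simple_graph_def by auto

text \<open>This holds for all numbers: indices outside the matrix give \<open>False\<close>, and
  edges of \<open>G\<close> join vertices below \<open>n\<close>.\<close>

lemma adj_iff: "adj M u v \<longleftrightarrow> {u, v} \<in> edges G"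
  using edge_less[of u v] by (auto simp: adj_def M_eq nth_default_def neighbors_def)

lemma adj_commute: "adj M u v \<longleftrightarrow> adj M v u"
  by (simp add: adj_iff insert_commute)

lemma not_adj_self [simp]: "\<not> adj M v v"
  using loop_free[OF simple] by (simp add: adj_iff)

section \<open>Peeling off maximal independent sets\<close>

definition indep :: "nat set \<Rightarrow> bool" where
  "indep S \<longleftrightarrow> (\<forall>u\<in>S. \<forall>v\<in>S. \<not> adj M u v)"

text \<open>A vertex is rejected only if it has a neighbor in the current set, and the set never
  loses elements; this gives maximality.\<close>

lemma mis_properties:
  assumes "distinct R"
  shows "distinct (mis M R) \<and> set (mis M R) \<subseteq> set R \<and> indep (set (mis M R)) \<and>
    (\<forall>v\<in>set R - set (mis M R). \<exists>u\<in>set (mis M R). adj M v u)"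
  using assms
proof (induction R rule: rev_induct)
  case (snoc v R)
  define I where "I = mis M R"
  have IH: "distinct I" "set I \<subseteq> set R" "indep (set I)" "\<forall>v\<in>set R - set I. \<exists>u\<in>set I. adj M v u"
    "v \<notin> set R"
    using snoc by (auto simp: I_def)
  have mis: "mis M (R @ [v]) = (if list_ex (adj M v) I then I else v # I)"
    by (simp add: mis_def I_def)
  show ?case
  proof (cases "list_ex (adj M v) I")
    case True
    then show ?thesis unfolding mis using IH by (auto simp: list_ex_iff)
  next
    case False
    then have "indep (set (v # I))"
      using IH(3) adj_commute by (auto simp: indep_def list_ex_iff)
    then show ?thesis unfolding mis using False IH by auto
  qed
qed (simp add: mis_def indep_def)

text \<open>The last clause drives the argument: every remaining vertex sees all colors used so far,
  so it can witness the next color.\<close>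

definition peel_inv :: "nat list \<times> nat list list \<Rightarrow> bool" where
  "peel_inv s \<longleftrightarrow> distinct (fst s) \<and> set (fst s) \<subseteq> {..<n} \<and>
     (\<forall>C\<in>set (snd s). distinct C \<and> set C \<subseteq> {..<n} \<and> indep (set C)) \<and>
     {..<n} - set (fst s) \<subseteq> (\<Union>C\<in>set (snd s). set C) \<and>
     (\<exists>c. grundy_on G ({..<n} - set (fst s)) (length (snd s)) c \<and>
        (\<forall>v\<in>set (fst s). \<forall>j\<in>{1..length (snd s)}. \<exists>u\<in>{..<n} - set (fst s). adj M v u \<and> c u = j))"

text \<open>The new class gets color \<open>m + 1\<close>. Any of its vertices is a witness because
  it saw all of the colors up to \<open>m\<close>, and by maximality every vertex still remaining
  has a neighbor in the new class.\<close>

lemma peel_inv_peel: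
  assumes s: "peel_inv s" and ne: "fst s \<noteq> []"
  shows "peel_inv (peel M s)" and "length (fst (peel M s)) < length (fst s)"
proof -
  define R I where "R = fst s" and "I = mis M R"
  define m where "m = length (snd s)"
  define S where "S = {..<n} - set R"
  have R: "distinct R" "set R \<subseteq> {..<n}" using s by (auto simp: peel_inv_def R_def)
  have I: "distinct I" "set I \<subseteq> set R" "indep (set I)" "\<And>v. v \<in> set R - set I \<Longrightarrow> \<exists>u\<in>set I. adj M v u"
    using mis_properties[OF R(1)] by (auto simp: I_def)
  have I_ne: "set I \<noteq> {}"
  proof
    assume "set I = {}"
    moreover have "hd R \<in> set R" using ne by (simp add: R_def)
    ultimately show False using I(4)[of "hd R"] by auto
  qed
  have peel: "peel M s = (filter (\<lambda>v. v \<notin> set I) R, I # snd s)"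
    using ne by (simp add: peel_def R_def I_def)
  show "length (fst (peel M s)) < length (fst s)"
  proof -
    have "hd I \<in> set R" "hd I \<in> set I" using I_ne I(2) by auto
    then have "length (filter (\<lambda>v. v \<notin> set I) R) < length R" by (auto intro: length_filter_less)
    then show ?thesis by (simp add: peel R_def)
  qed
  obtain c where c: "grundy_on G S m c" "\<And>v j. v \<in> set R \<Longrightarrow> j \<in> {1..m} \<Longrightarrow> \<exists>u\<in>S. adj M v u \<and> c u = j"
    using s by (auto simp: peel_inv_def S_def R_def m_def)
  have S': "{..<n} - set (fst (peel M s)) = S \<union> set I"
    using I(2) R(2) by (auto simp: peel S_def)
  have disj: "S \<inter> set I = {}" using I(2) by (auto simp: S_def)
  define c' where "c' = (\<lambda>v. if v \<in> set I then Suc m else c v)"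
  have c'I: "c' v = Suc m" if "v \<in> set I" for v using that by (simp add: c'_def)
  have c'S: "c' v = c v" if "v \<in> S" for v using that disj by (auto simp: c'_def)
  have cS: "c v \<in> {1..m}" if "v \<in> S" for v using c(1) that by (auto simp: grundy_on_def)
  have "grundy_on G (S \<union> set I) (Suc m) c'"
    unfolding grundy_on_def
  proof (intro conjI ballI impI)
    show "S \<union> set I \<subseteq> verts G" using I(2) R(2) by (auto simp: S_def verts_G)
    show "c' ` (S \<union> set I) \<subseteq> {1..Suc m}" using cS by (fastforce simp: c'I c'S)
  next
    fix u v assume uv: "u \<in> S \<union> set I" "v \<in> S \<union> set I" "{u, v} \<in> edges G"
    then have "\<not> (u \<in> set I \<and> v \<in> set I)" using I(3) by (auto simp: indep_def adj_iff)
    with uv c(1) cS[of u] cS[of v] show "c' u \<noteq> c' v"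
      by (auto simp: grundy_on_def c'I c'S)
  next
    fix i assume i: "i \<in> {1..Suc m}"
    show "\<exists>v\<in>S \<union> set I. c' v = i \<and> (\<forall>j\<in>{1..<i}. \<exists>u\<in>S \<union> set I. {v, u} \<in> edges G \<and> c' u = j)"
    proof (cases "i = Suc m")
      case True
      obtain v where v: "v \<in> set I" using I_ne by (meson all_not_in_conv)
      have "\<exists>u\<in>S \<union> set I. {v, u} \<in> edges G \<and> c' u = j" if "j \<in> {1..<i}" for j
        using c(2)[of v j] v I(2) that True c'S by (auto simp: adj_iff)
      then show ?thesis using v True c'I by blast
    next
      case False
      then have "i \<in> {1..m}" using i by auto
      then obtain v where "v \<in> S" "c v = i" "\<forall>j\<in>{1..<i}. \<exists>u\<in>S. {v, u} \<in> edges G \<and> c u = j"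
        using c(1) unfolding grundy_on_def by blast
      then show ?thesis using c'S by (metis UnI1)
    qed
  qed
  moreover have "\<exists>u\<in>S \<union> set I. adj M v u \<and> c' u = j"
    if v: "v \<in> set R - set I" and j: "j \<in> {1..Suc m}" for v j
  proof (cases "j = Suc m")
    case True
    then show ?thesis using I(4)[OF v] c'I by blast
  next
    case False
    then show ?thesis using c(2)[of v j] v j c'S by fastforce
  qed
  moreover have "fst (peel M s) = filter (\<lambda>v. v \<notin> set I) R" "snd (peel M s) = I # snd s"
    by (simp_all add: peel)
  ultimately show "peel_inv (peel M s)"
    unfolding peel_inv_def S'
    using R I s by (auto simp: peel_inv_def m_def S_def R_def)
qed

lemma classes_properties:
  shows classes_indep: "C \<in> set (classes M) \<Longrightarrow> distinct C \<and> set C \<subseteq> {..<n} \<and> indep (set C)"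
    and classes_cover: "v < n \<Longrightarrow> \<exists>C\<in>set (classes M). v \<in> set C"
    and classes_grundy: "\<exists>c. grundy_on G {..<n} (length (classes M)) c"
proof -
  define s where "s = foldl (\<lambda>s _. peel M s) ([0..<n], []) [0..<n]"
  have "peel_inv (foldl (\<lambda>s _. peel M s) ([0..<n], []) xs) \<and>
     length (fst (foldl (\<lambda>s _. peel M s) ([0..<n], []) xs)) \<le> n - length xs" for xs :: "nat list"
  proof (induction xs rule: rev_induct)
    case Nil
    then show ?case by (auto simp: peel_inv_def grundy_on_def)
  next
    case (snoc x xs)
    define s where "s = foldl (\<lambda>s _. peel M s) ([0..<n], []) xs"
    show ?case
    proof (cases "fst s = []")
      case True
      then show ?thesis using snoc by (simp add: s_def peel_def)
    next
      case False
      have "peel_inv s" "length (fst s) \<le> n - length xs" using snoc by (simp_all add: s_def)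
      with peel_inv_peel[OF _ False]
      have "peel_inv (peel M s)" "length (fst (peel M s)) \<le> n - Suc (length xs)" by force+
      then show ?thesis by (simp add: s_def)
    qed
  qed
  from this[of "[0..<n]"] have s: "peel_inv s" "fst s = []" by (simp_all add: s_def)
  have cl: "classes M = snd s" by (simp add: classes_def s_def)
  show "C \<in> set (classes M) \<Longrightarrow> distinct C \<and> set C \<subseteq> {..<n} \<and> indep (set C)"
    using s by (simp add: peel_inv_def cl)
  show "v < n \<Longrightarrow> \<exists>C\<in>set (classes M). v \<in> set C"
    using s by (auto simp: peel_inv_def cl)
  show "\<exists>c. grundy_on G {..<n} (length (classes M)) c"
    using s by (auto simp: peel_inv_def cl)
qed

section \<open>Centers of an ordered pair of classes\<close>

abbreviation deg_into :: "nat list \<Rightarrow> nat \<Rightarrow> nat" where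
  "deg_into B x \<equiv> length (filter (adj M x) B)"

lemma by_degree_properties:
  shows set_by_degree: "set (by_degree M A B) = set A"
    and sorted_by_degree: "sorted_wrt (\<lambda>x y. deg_into B y \<le> deg_into B x) (by_degree M A B)"
proof -
  \<comment> \<open>No degree exceeds the last bucket, so no vertex of \<open>A\<close> is
    lost.\<close>
  have "deg_into B x < Suc (length B)" for x by (simp add: less_Suc_eq_le)
  then show "set (by_degree M A B) = set A"
    by (auto simp: by_degree_def simp del: upt_Suc)
  have const: "sorted_wrt (\<lambda>x y. f y \<le> f x) (filter (\<lambda>x. f x = d) xs)" for f :: "nat \<Rightarrow> nat" and d xs
    by (induction xs) auto
  have "sorted_wrt (\<lambda>x y. f y \<le> f x) (concat (map (\<lambda>d. filter (\<lambda>x. f x = d) A) (rev [0..<m])))"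
    for f :: "nat \<Rightarrow> nat" and m
    by (induction m) (auto simp: sorted_wrt_append const)
  then show "sorted_wrt (\<lambda>x y. deg_into B y \<le> deg_into B x) (by_degree M A B)"
    unfolding by_degree_def .
qed

text \<open>Stronger than a partial Grundy coloring of the subgraph on centers and chosen vertices:
  the centers realize all colors, and every center sees all colors below its own. In this form the
  property survives shifting all colors by one.\<close>

definition center_coloring :: "nat list \<Rightarrow> nat list \<Rightarrow> (nat \<Rightarrow> nat) \<Rightarrow> bool" where
  "center_coloring W U c \<longleftrightarrow>
     c ` (set W \<union> set U) \<subseteq> {1..length W} \<and>
     (\<forall>u\<in>set W \<union> set U. \<forall>v\<in>set W \<union> set U. adj M u v \<longrightarrow> c u \<noteq> c v) \<and>
     {1..length W} \<subseteq> c ` set W \<and>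
     (\<forall>w\<in>set W. \<forall>j\<in>{1..<c w}. \<exists>u\<in>set W \<union> set U. adj M w u \<and> c u = j)"

text \<open>In the last clause \<open>w\<close> is \<open>x\<close> itself if \<open>x\<close> was
  accepted, and otherwise a center that blocked \<open>x\<close>. It says that N(w) - U is contained
  in N(x) within \<open>B\<close>, for a \<open>w\<close> of at least the degree of
  \<open>x\<close>.\<close>

definition centers_inv :: "nat list \<Rightarrow> nat list \<Rightarrow> nat list \<Rightarrow> nat list \<times> nat list \<Rightarrow> bool" where
  "centers_inv A B ys s \<longleftrightarrow>
     set (fst s) \<subseteq> set ys \<and> length (snd s) \<le> length (fst s) * length (fst s) \<and>
     set (snd s) \<subseteq> set B - set A \<and>
     (\<exists>c. center_coloring (fst s) (snd s) c) \<and>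
     (\<forall>x\<in>set ys. \<exists>w\<in>set (fst s). deg_into B x \<le> deg_into B w \<and>
        (\<forall>y\<in>set B. adj M w y \<longrightarrow> adj M x y \<or> y \<in> set (snd s)))"

text \<open>A rejected \<open>x\<close> has a blocking center, which was scanned earlier and so has
  at least its degree. For an accepted \<open>x\<close>, the vertex and the newly chosen vertices
  form an independent set: the latter lie in \<open>B\<close> and avoid N(x). They get color 1; each
  old center sees this color through its own chosen vertex and the shifted old colors as
  before.\<close>

lemma centers_inv_step:
  assumes s: "centers_inv A B ys s" and A: "indep (set A)" "set ys \<subseteq> set A" "x \<in> set A"
    and B: "indep (set B)" and le: "\<forall>y\<in>set ys. deg_into B x \<le> deg_into B y"
  shows "centers_inv A B (ys @ [x]) (try_center M B s x)"
proof -
  define W U where "W = fst s" and "U = snd s"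
  have W: "set W \<subseteq> set ys" and U: "set U \<subseteq> set B - set A" and len: "length U \<le> length W * length W"
    and cover: "\<And>x. x \<in> set ys \<Longrightarrow> \<exists>w\<in>set W. deg_into B x \<le> deg_into B w \<and>
        (\<forall>y\<in>set B. adj M w y \<longrightarrow> adj M x y \<or> y \<in> set U)"
    using s by (auto simp: centers_inv_def W_def U_def)
  obtain c where cc: "center_coloring W U c"
    using s unfolding centers_inv_def W_def[symmetric] U_def[symmetric] by blast
  have c: "c ` (set W \<union> set U) \<subseteq> {1..length W}"
    "\<And>u v. u \<in> set W \<union> set U \<Longrightarrow> v \<in> set W \<union> set U \<Longrightarrow> adj M u v \<Longrightarrow> c u \<noteq> c v"
    "{1..length W} \<subseteq> c ` set W"
    "\<And>w j. w \<in> set W \<Longrightarrow> j \<in> {1..<c w} \<Longrightarrow> \<exists>u\<in>set W \<union> set U. adj M w u \<and> c u = j"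
    using cc unfolding center_coloring_def by fast+
  show ?thesis
  proof (cases "list_all (\<lambda>w. candidates M B U x w \<noteq> []) W")
    case False
    then obtain w where w: "w \<in> set W" "candidates M B U x w = []" by (auto simp: list_all_iff)
    then have "\<forall>y\<in>set B. adj M w y \<longrightarrow> adj M x y \<or> y \<in> set U"
      by (auto simp: candidates_def filter_empty_conv)
    moreover have "deg_into B x \<le> deg_into B w" using w(1) W le by auto
    moreover have "try_center M B s x = s" using False by (auto simp: try_center_def W_def U_def)
    ultimately have "\<exists>w\<in>set W. deg_into B z \<le> deg_into B w \<and>
        (\<forall>y\<in>set B. adj M w y \<longrightarrow> adj M z y \<or> y \<in> set U)" if "z \<in> set (ys @ [x])" for z
      using that cover[of z] w(1) by (cases "z = x") auto
    moreover have "set W \<subseteq> set (ys @ [x])" using W by auto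
    ultimately show ?thesis
      unfolding \<open>try_center M B s x = s\<close> centers_inv_def W_def[symmetric] U_def[symmetric]
      using U len cc by blast
  next
    case True
    define p where "p = (\<lambda>w. nth_default 0 (candidates M B U x w) 0)"
    have p: "p w \<in> set B" "adj M w (p w)" "\<not> adj M x (p w)" "p w \<notin> set U" if "w \<in> set W" for w
    proof -
      have "p w \<in> set (candidates M B U x w)"
        using True that by (auto simp: p_def list_all_iff nth_default_def)
      then show "p w \<in> set B" "adj M w (p w)" "\<not> adj M x (p w)" "p w \<notin> set U"
        by (auto simp: candidates_def)
    qed
    \<comment> \<open>A neighbor of a center cannot lie in the independent set \<open>A\<close>;
      this also covers the case \<open>A = B\<close>.\<close>
    have pA: "p w \<notin> set A" if "w \<in> set W" for w
      using p(2)[OF that] that W A by (auto simp: indep_def)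
    define U' where "U' = map p W @ U"
    have s': "try_center M B s x = (x # W, U')"
      using True by (simp add: try_center_def W_def U_def U'_def p_def)
    \<comment> \<open>Were \<open>x\<close> already a center, \<open>p x\<close> would be both
      adjacent and not adjacent to \<open>x\<close>.\<close>
    have xW: "x \<notin> set W" using p(2,3) by blast
    have xU: "x \<notin> set U" using U A by auto
    define N where "N = insert x (p ` set W)"
    have N: "N \<inter> (set W \<union> set U) = {}"
      using xW xU p(4) pA W A(2) by (auto simp: N_def)
    define c' where "c' = (\<lambda>v. if v \<in> N then 1 else Suc (c v))"
    have c'N: "c' v = 1" if "v \<in> N" for v using that by (simp add: c'_def)
    have c'O: "c' v = Suc (c v)" if "v \<in> set W \<union> set U" for v using that N by (auto simp: c'_def)
    have S': "set (x # W) \<union> set U' = N \<union> (set W \<union> set U)" by (auto simp: N_def U'_def)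
    have N_indep: "\<not> adj M u v" if "u \<in> N" "v \<in> N" for u v
      using that p B adj_commute by (auto simp: N_def indep_def)
    have cpos: "1 \<le> c v" if "v \<in> set W \<union> set U" for v using c(1) that by auto
    have "c' ` (N \<union> (set W \<union> set U)) \<subseteq> {1..length (x # W)}"
      using c(1) by (auto simp: c'N c'O)
    moreover have "c' u \<noteq> c' v"
      if "u \<in> N \<union> (set W \<union> set U)" "v \<in> N \<union> (set W \<union> set U)" "adj M u v" for u v
      using that N_indep[of u v] c(2)[of u v] cpos[of u] cpos[of v]
      by (cases "u \<in> N"; cases "v \<in> N") (auto simp: c'N c'O)
    moreover have "{1..length (x # W)} \<subseteq> c' ` set (x # W)"
    proof
      fix i assume i: "i \<in> {1..length (x # W)}"
      show "i \<in> c' ` set (x # W)"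
      proof (cases "i = 1")
        case True
        then show ?thesis using c'N[of x] by (auto simp: N_def)
      next
        case False
        then have "i - 1 \<in> {1..length W}" using i by auto
        then have "i - 1 \<in> c ` set W" using c(3) by (rule subsetD[rotated])
        then obtain w where "w \<in> set W" "c w = i - 1" by auto
        then show ?thesis using c'O[of w] False i by (auto intro!: image_eqI[of _ _ w])
      qed
    qed
    moreover have "\<exists>u\<in>N \<union> (set W \<union> set U). adj M w u \<and> c' u = j"
      if w: "w \<in> set (x # W)" and j: "j \<in> {1..<c' w}" for w j
    proof -
      \<comment> \<open>The new center \<open>x\<close> has color 1, so there is no \<open>j\<close>
        to be found for it.\<close>
      have wW: "w \<in> set W" using w j c'N[of x] by (auto simp: N_def)
      show ?thesis
      proof (cases "j = 1")
        case True
        then show ?thesis using p(2)[OF wW] c'N[of "p w"] wW by (auto simp: N_def)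
      next
        case False
        then have "j - 1 \<in> {1..<c w}" using j c'O[of w] wW by auto
        from c(4)[OF wW this] obtain u where "u \<in> set W \<union> set U" "adj M w u" "c u = j - 1" by blast
        then show ?thesis using c'O[of u] False j by (intro bexI[of _ u]) auto
      qed
    qed
    ultimately have col: "center_coloring (x # W) U' c'"
      unfolding center_coloring_def S' by blast
    have "\<exists>w\<in>set (x # W). deg_into B z \<le> deg_into B w \<and>
        (\<forall>y\<in>set B. adj M w y \<longrightarrow> adj M z y \<or> y \<in> set U')" if "z \<in> set (ys @ [x])" for z
    proof (cases "z = x")
      case True
      then show ?thesis by auto
    next
      case False
      then have "z \<in> set ys" using that by simp
      from cover[OF this] show ?thesis by (auto simp: U'_def)
    qed
    moreover have "set U' \<subseteq> set B - set A" using U p(1) pA by (auto simp: U'_def)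
    \<comment> \<open>With r old centers, r * r + r <= (r + 1) * (r + 1).\<close>
    moreover have "length U' \<le> length (x # W) * length (x # W)" using len by (simp add: U'_def)
    moreover have "set (x # W) \<subseteq> set (ys @ [x])" using W by auto
    ultimately show ?thesis
      unfolding s' centers_inv_def fst_conv snd_conv using col by blast
  qed
qed

lemma centers_inv_centers:
  assumes "indep (set A)" "indep (set B)"
  shows "centers_inv A B (by_degree M A B) (centers M A B)"
proof -
  have "set ys \<subseteq> set A \<Longrightarrow> sorted_wrt (\<lambda>x y. deg_into B y \<le> deg_into B x) ys \<Longrightarrow>
      centers_inv A B ys (foldl (try_center M B) ([], []) ys)" for ys
  proof (induction ys rule: rev_induct)
    case Nil
    then show ?case by (simp add: centers_inv_def center_coloring_def)
  next
    case (snoc x ys)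
    then have "centers_inv A B ys (foldl (try_center M B) ([], []) ys)"
      by (simp add: sorted_wrt_append)
    from centers_inv_step[OF this assms(1) _ _ assms(2), of x] snoc.prems show ?case
      by (simp add: sorted_wrt_append)
  qed
  then show ?thesis
    unfolding centers_def using set_by_degree sorted_by_degree by simp
qed

text \<open>This supplies the coloring with \<open>k\<close> colors when some pair of classes has at
  least \<open>k\<close> centers.\<close>

lemma centers_grundy:
  assumes A: "indep (set A)" "set A \<subseteq> {..<n}" and B: "indep (set B)" "set B \<subseteq> {..<n}"
  shows "\<exists>S c. grundy_on G S (length (fst (centers M A B))) c"
proof -
  define W U where "W = fst (centers M A B)" and "U = snd (centers M A B)"
  have inv: "centers_inv A B (by_degree M A B) (centers M A B)" by (rule centers_inv_centers[OF A(1) B(1)])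
  obtain c where cc: "center_coloring W U c"
    using inv unfolding centers_inv_def W_def[symmetric] U_def[symmetric] by blast
  have c: "c ` (set W \<union> set U) \<subseteq> {1..length W}"
    "\<And>u v. u \<in> set W \<union> set U \<Longrightarrow> v \<in> set W \<union> set U \<Longrightarrow> adj M u v \<Longrightarrow> c u \<noteq> c v"
    "{1..length W} \<subseteq> c ` set W"
    "\<And>w j. w \<in> set W \<Longrightarrow> j \<in> {1..<c w} \<Longrightarrow> \<exists>u\<in>set W \<union> set U. adj M w u \<and> c u = j"
    using cc unfolding center_coloring_def by fast+
  have "set W \<union> set U \<subseteq> {..<n}"
    using inv A(2) B(2) set_by_degree[of A B] by (auto simp: centers_inv_def W_def U_def)
  moreover have "\<exists>v\<in>set W \<union> set U. c v = i \<and> (\<forall>j\<in>{1..<i}. \<exists>u\<in>set W \<union> set U. {v, u} \<in> edges G \<and> c u = j)"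
    if i: "i \<in> {1..length W}" for i
  proof -
    obtain w where "w \<in> set W" "c w = i" using subsetD[OF c(3) i] by auto
    then show ?thesis using c(4)[of w] by (auto simp: adj_iff)
  qed
  ultimately have "grundy_on G (set W \<union> set U) (length W) c"
    using c(1,2) unfolding grundy_on_def verts_G adj_iff by blast
  then show ?thesis unfolding W_def by blast
qed

text \<open>If \<open>w\<close> rejected \<open>v\<close>, then \<open>N(w) - N(v)\<close> lies in \<open>U\<close>, and it is at least as large as
  \<open>N(v) - N(w)\<close> by the order in which \<open>A\<close> is scanned.\<close>

lemma residual_degree:
  assumes A: "indep (set A)" and B: "indep (set B)" "distinct B" and v: "v \<in> set A"
  shows "card {y \<in> set B. adj M v y \<and> \<not> (\<exists>w\<in>set (fst (centers M A B)).
      y \<in> set (right_side M B (snd (centers M A B)) w) \<and>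
      list_all (adj M v) (right_side M B (snd (centers M A B)) w))}
    \<le> length (snd (centers M A B))" (is "card ?X \<le> _")
proof -
  define W U where "W = fst (centers M A B)" and "U = snd (centers M A B)"
  have "\<exists>w\<in>set W. deg_into B v \<le> deg_into B w \<and> (\<forall>y\<in>set B. adj M w y \<longrightarrow> adj M v y \<or> y \<in> set U)"
    using centers_inv_centers[OF A B(1)] v set_by_degree[of A B]
    by (auto simp: centers_inv_def W_def U_def)
  then obtain w where w: "w \<in> set W" "deg_into B v \<le> deg_into B w"
    "\<And>y. y \<in> set B \<Longrightarrow> adj M w y \<Longrightarrow> adj M v y \<or> y \<in> set U" by blast
  define Nv Nw where "Nv = {y \<in> set B. adj M v y}" and "Nw = {y \<in> set B. adj M w y}"
  have fin: "finite Nv" "finite Nw" by (auto simp: Nv_def Nw_def)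
  have card: "deg_into B x = card {y \<in> set B. adj M x y}" for x
    using distinct_card[of "filter (adj M x) B"] B(2) by simp
  have "card (Nv - Nw) \<le> card (Nw - Nv)"
  proof -
    have "card Nv \<le> card Nw" using w(2) by (simp add: card Nv_def Nw_def)
    moreover have "card Nv = card (Nv \<inter> Nw) + card (Nv - Nw)"
      using fin by (metis card_Int_Diff)
    moreover have "card Nw = card (Nv \<inter> Nw) + card (Nw - Nv)"
      using fin by (metis card_Int_Diff inf_commute)
    ultimately show ?thesis by simp
  qed
  have all: "list_all (adj M v) (right_side M B U w)"
    using w(3) by (auto simp: right_side_def list_all_iff)
  \<comment> \<open>A common neighbor of \<open>v\<close> and \<open>w\<close> outside
    \<open>U\<close> lies on the right side of \<open>w\<close>, all of which is adjacent to
    \<open>v\<close>; such a vertex is not counted in \<open>?X\<close>.\<close>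
  have "?X \<subseteq> (Nv - Nw) \<union> (Nv \<inter> Nw \<inter> set U)"
    using all w(1) by (auto simp: Nv_def Nw_def right_side_def W_def U_def)
  then have "card ?X \<le> card ((Nv - Nw) \<union> (Nv \<inter> Nw \<inter> set U))"
    using fin by (intro card_mono) auto
  also have "\<dots> \<le> card (Nv - Nw) + card (Nv \<inter> Nw \<inter> set U)" by (rule card_Un_le)
  \<comment> \<open>Exchanging \<open>Nv - Nw\<close> for \<open>Nw - Nv\<close> leaves two disjoint
    subsets of \<open>U\<close>, so \<open>U\<close> is counted only once.\<close>
  also have "\<dots> \<le> card (Nw - Nv) + card (Nv \<inter> Nw \<inter> set U)" using \<open>card (Nv - Nw) \<le> _\<close> by simp
  also have "\<dots> = card ((Nw - Nv) \<union> (Nv \<inter> Nw \<inter> set U))"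
    using fin by (intro card_Un_disjoint[symmetric]) auto
  also have "\<dots> \<le> card (set U)"
    using w(3) by (intro card_mono) (auto simp: Nv_def Nw_def)
  also have "\<dots> \<le> length U" by (rule card_length)
  finally show ?thesis by (simp add: U_def)
qed

section \<open>The output sets induce bicliques\<close>

definition induced :: "nat set \<Rightarrow> nat ugraph" where
  "induced S = \<lparr>verts = S, edges = {e \<in> edges G. e \<subseteq> S}\<rparr>"

definition true_positions :: "bool list \<Rightarrow> nat set" where
  "true_positions bs = {v. v < n \<and> bs ! v}"

lemma all_bicliques_iff:
  "bs \<in> set (all_bicliques M) \<longleftrightarrow> (\<exists>A\<in>set (classes M). \<exists>B\<in>set (classes M).
     \<exists>w\<in>set (fst (centers M A B)). right_side M B (snd (centers M A B)) w \<noteq> [] \<and>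
     bs = map (\<lambda>v. v \<in> set (right_side M B (snd (centers M A B)) w) \<or>
               v \<in> set A \<and> list_all (adj M v) (right_side M B (snd (centers M A B)) w)) [0..<n])"
  by (auto simp: all_bicliques_def bicliques_def)

text \<open>The sides lie in the independent sets \<open>A\<close> and \<open>B\<close>, so no edge
  runs inside a side, and all cross pairs are adjacent by the choice of the left side. The left side
  is nonempty because it contains the center \<open>w\<close>.\<close>

lemma biclique_induced:
  assumes "bs \<in> set (all_bicliques M)"
  shows "length bs = n" "biclique (induced (true_positions bs))"
proof -
  obtain A B w where A: "A \<in> set (classes M)" and B: "B \<in> set (classes M)"
    and w: "w \<in> set (fst (centers M A B))" and ne: "right_side M B (snd (centers M A B)) w \<noteq> []"
    and bs: "bs = map (\<lambda>v. v \<in> set (right_side M B (snd (centers M A B)) w) \<or>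
               v \<in> set A \<and> list_all (adj M v) (right_side M B (snd (centers M A B)) w)) [0..<n]"
    using assms unfolding all_bicliques_iff by blast
  show "length bs = n" by (simp add: bs)
  define R where "R = set (right_side M B (snd (centers M A B)) w)"
  define L where "L = {v \<in> set A. \<forall>y\<in>R. adj M v y}"
  have AB: "indep (set A)" "set A \<subseteq> {..<n}" "indep (set B)" "set B \<subseteq> {..<n}"
    using classes_indep A B by auto
  have R_ne: "R \<noteq> {}" using ne by (simp add: R_def)
  have RB: "R \<subseteq> set B" and wR: "\<And>y. y \<in> R \<Longrightarrow> adj M w y"
    by (auto simp: R_def right_side_def)
  have "w \<in> set A"
    using w centers_inv_centers[OF AB(1,3)] set_by_degree[of A B] by (auto simp: centers_inv_def)
  then have L_ne: "L \<noteq> {}" using wR by (auto simp: L_def)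
  have LR: "\<And>x y. x \<in> L \<Longrightarrow> y \<in> R \<Longrightarrow> adj M x y" by (simp add: L_def)
  have pos: "true_positions bs = L \<union> R"
    using AB(2,4) RB by (auto simp: true_positions_def bs R_def[symmetric] L_def list_all_iff)
  have "L \<inter> R = {}" using LR not_adj_self by blast
  moreover have "\<exists>x\<in>L. \<exists>y\<in>R. e = {x, y}" if e: "e \<in> edges G" "e \<subseteq> L \<union> R" for e
  proof -
    obtain a b where ab: "e = {a, b}"
      using e(1) simple unfolding finite_simple_graph_def by (metis card_2_iff)
    then have adj: "adj M a b" using e(1) by (simp add: adj_iff)
    have "\<not> (a \<in> L \<and> b \<in> L)" "\<not> (a \<in> R \<and> b \<in> R)"
      using adj AB(1,3) subsetD[OF RB] by (auto simp: indep_def L_def)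
    then consider "a \<in> L" "b \<in> R" | "a \<in> R" "b \<in> L" using e(2) ab by auto
    then show ?thesis by cases (use ab in blast)+
  qed
  ultimately have "bipartition (induced (L \<union> R)) L R"
    by (auto simp: bipartition_def induced_def)
  moreover have "\<forall>x\<in>L. \<forall>y\<in>R. {x, y} \<in> edges (induced (L \<union> R))"
    using LR by (auto simp: induced_def adj_iff)
  ultimately show "biclique (induced (true_positions bs))"
    unfolding pos biclique_def using L_ne R_ne by blast
qed

section \<open>Number of bicliques and remaining degree\<close>

context
  fixes k :: nat
  assumes few_classes: "length (classes M) \<le> k"
    and few_centers: "\<And>A B. A \<in> set (classes M) \<Longrightarrow> B \<in> set (classes M) \<Longrightarrow> length (fst (centers M A B)) \<le> k"
begin

text \<open>There are at most k * k ordered pairs of classes, and each pair yields at most one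
  biclique per center.\<close>

lemma length_all_bicliques: "length (all_bicliques M) \<le> k ^ 3"
proof -
  have 1: "length (bicliques M A B) \<le> k" if "A \<in> set (classes M)" "B \<in> set (classes M)" for A B
    unfolding bicliques_def length_map using few_centers[OF that] by (rule le_trans[OF length_filter_le])
  have 2: "length (concat (map (bicliques M A) (classes M))) \<le> k * k" if "A \<in> set (classes M)" for A
  proof -
    have "length (concat (map (bicliques M A) (classes M))) \<le> length (map (bicliques M A) (classes M)) * k"
      by (rule length_concat_le) (auto simp: 1[OF that])
    also have "\<dots> \<le> k * k" using few_classes by simp
    finally show ?thesis .
  qed
  have "length (all_bicliques M) \<le> length (map (\<lambda>A. concat (map (bicliques M A) (classes M))) (classes M)) * (k * k)"
    unfolding all_bicliques_def by (rule length_concat_le) (use 2 in auto)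
  also have "\<dots> \<le> k * (k * k)" using few_classes by (intro mult_right_mono) auto
  finally show ?thesis by (simp add: power3_eq_cube)
qed

text \<open>Fix a class \<open>A\<close> containing \<open>v\<close>. For each class
  \<open>B\<close>, at most \<open>length (snd (centers M A B))\<close>, hence at most k * k,
  neighbors of \<open>v\<close> in \<open>B\<close> escape the bicliques of the pair; the classes
  cover all vertices and number at most \<open>k\<close>.\<close>

lemma degree_delete_bicliques:
  assumes v: "v < n"
  shows "degree_in (delete_edges G (\<Union>bs\<in>set (all_bicliques M). edges (induced (true_positions bs)))) v
    \<le> k ^ 3" (is "degree_in (delete_edges G ?F) v \<le> _")
proof -
  obtain A where A: "A \<in> set (classes M)" "v \<in> set A" using classes_cover[OF v] by blast
  define X where "X = (\<lambda>B. {y \<in> set B. adj M v y \<and> \<not> (\<exists>w\<in>set (fst (centers M A B)).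
      y \<in> set (right_side M B (snd (centers M A B)) w) \<and>
      list_all (adj M v) (right_side M B (snd (centers M A B)) w))})"
  have X: "card (X B) \<le> k * k" if B: "B \<in> set (classes M)" for B
  proof -
    have AB: "indep (set A)" "indep (set B)" "distinct B" using classes_indep A B by auto
    have "card (X B) \<le> length (snd (centers M A B))"
      unfolding X_def by (rule residual_degree[OF AB A(2)])
    also have "\<dots> \<le> length (fst (centers M A B)) * length (fst (centers M A B))"
      using centers_inv_centers[OF AB(1,2)] by (simp add: centers_inv_def)
    also have "\<dots> \<le> k * k" using few_centers[OF A(1) B] by (simp add: mult_le_mono)
    finally show ?thesis .
  qed
  have "neighbors (delete_edges G ?F) v \<subseteq> (\<Union>B\<in>set (classes M). X B)"
  proof
    fix y assume "y \<in> neighbors (delete_edges G ?F) v"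
    then have vy: "{v, y} \<in> edges G" "{v, y} \<notin> ?F" by (auto simp: neighbors_def delete_edges_def)
    then have "y < n" using edge_less by blast
    then obtain B where B: "B \<in> set (classes M)" "y \<in> set B" using classes_cover by blast
    \<comment> \<open>If the right side of \<open>w\<close> contains \<open>y\<close> and lies in
      N(v), then \<open>v\<close> is on the left side of that biclique, so the edge to
      \<open>y\<close> has been deleted.\<close>
    have False if w: "w \<in> set (fst (centers M A B))" "y \<in> set (right_side M B (snd (centers M A B)) w)"
      "list_all (adj M v) (right_side M B (snd (centers M A B)) w)" for w
    proof -
      let ?bs = "map (\<lambda>v. v \<in> set (right_side M B (snd (centers M A B)) w) \<or>
               v \<in> set A \<and> list_all (adj M v) (right_side M B (snd (centers M A B)) w)) [0..<n]"
      have "right_side M B (snd (centers M A B)) w \<noteq> []" using w(2) by auto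
      then have "?bs \<in> set (all_bicliques M)" unfolding all_bicliques_iff using A(1) B(1) w(1) by blast
      moreover have "{v, y} \<in> edges (induced (true_positions ?bs))"
        using vy(1) v \<open>y < n\<close> w(2,3) A(2) by (simp add: induced_def true_positions_def)
      ultimately show False using vy(2) by blast
    qed
    then have "y \<in> X B" using B(2) vy(1) by (auto simp: X_def adj_iff)
    then show "y \<in> (\<Union>B\<in>set (classes M). X B)" using B(1) by blast
  qed
  moreover have "finite (\<Union>B\<in>set (classes M). X B)" by (auto simp: X_def)
  ultimately have "degree_in (delete_edges G ?F) v \<le> card (\<Union>B\<in>set (classes M). X B)"
    unfolding degree_in_def by (rule card_mono[rotated])
  also have "\<dots> \<le> (\<Sum>B\<in>set (classes M). card (X B))" by (rule card_UN_le) simp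
  also have "\<dots> \<le> card (set (classes M)) * (k * k)" using sum_bounded_above[of _ "\<lambda>B. card (X B)"] X by simp
  also have "\<dots> \<le> k * (k * k)"
    using few_classes card_length[of "classes M"] by (intro mult_right_mono) auto
  finally show ?thesis by (simp add: power3_eq_cube)
qed

end

section \<open>Assembling the answer and its encoding\<close>

definition answer_for :: "nat \<Rightarrow> answer" where
  "answer_for k = (if enough M (bits_of_nat k) then Enough_Colors
     else Subgraphs (map (\<lambda>bs. induced (true_positions bs)) (all_bicliques M)))"

lemma correct_answer_for:
  assumes k: "k \<ge> 1"
  shows "correct_answer G k (answer_for k)"
proof (cases "enough M (bits_of_nat k)")
  case True
  then have "\<exists>S m c. grundy_on G S m c \<and> k \<le> m"
    using classes_grundy classes_indep centers_grundy k
    by (simp add: enough_def at_least_iff list_ex_iff) blast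
  then show ?thesis
    using True grundy_on_imp_has_partial_Grundy[OF simple] by (auto simp: answer_for_def)
next
  case False
  then have few: "length (classes M) \<le> k"
    "\<And>A B. A \<in> set (classes M) \<Longrightarrow> B \<in> set (classes M) \<Longrightarrow> length (fst (centers M A B)) \<le> k"
    using k by (force simp: enough_def at_least_iff list_ex_iff not_le)+
  have "length (all_bicliques M) \<le> 2 * k ^ 3" using length_all_bicliques[OF few] by simp
  moreover have "is_induced_subgraph (induced (true_positions bs)) G" for bs
    by (auto simp: is_induced_subgraph_def induced_def true_positions_def verts_G)
  ultimately show ?thesis
    using False biclique_induced(2) degree_delete_bicliques[OF few]
    by (auto simp: answer_for_def verts_G)
qed

text \<open>The bit vectors have length \<open>n\<close>, so each is the characteristic vector of
  its own true positions; the tree computed by the program is therefore the encoded answer.\<close>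

lemma enc_answer_for:
  "enc_answer n (answer_for k) =
     (if enough M (bits_of_nat k) then Leaf else Node Leaf (enc_matrix (all_bicliques M)))"
proof -
  have "enc_vertex_set n (verts (induced (true_positions bs))) = enc_of_list tree_of_bool bs"
    if "bs \<in> set (all_bicliques M)" for bs
  proof -
    have "map (\<lambda>v. v \<in> true_positions bs) [0..<n] = bs"
      using biclique_induced(1)[OF that] by (intro nth_equalityI) (auto simp: true_positions_def)
    then show ?thesis by (simp add: enc_vertex_set_def induced_def enc_bits_def enc_of_list_def)
  qed
  then show ?thesis
    by (auto simp: answer_for_def enc_of_list_def[of "enc_of_list tree_of_bool"] o_def
      intro!: arg_cong[where f=enc_list])
qed

end

lemma enc_instance_eq:
  "enc_instance n G k = enc_pair enc_matrix (enc_of_list tree_of_bool)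
     (map (\<lambda>v. map (\<lambda>u. u \<in> neighbors G v) [0..<n]) [0..<n], bits_of_nat k)"
  by (simp add: enc_instance_def enc_pair_def enc_graph_def enc_vertex_set_def enc_bits_def
    enc_of_list_def o_def)

theorem theorem2:
  "\<exists>(c :: com) (p :: nat poly). \<forall>(n :: nat) (G :: nat ugraph) (k :: nat).
     finite_simple_graph G \<and> verts G = {..<n} \<and> k \<ge> 1 \<longrightarrow>
     (\<exists>t a. computes c (enc_instance n G k) t (enc_answer n a) \<and>
            t \<le> poly p (tree_size (enc_instance n G k)) \<and>
            correct_answer G k a)"
proof -
  let ?e = "enc_pair enc_matrix (enc_of_list tree_of_bool)"
  obtain c N b where c: "\<And>z. runs_in c N (?e z) (b z)
      (id (if enough (fst z) (snd z) then Leaf else Node Leaf (enc_matrix (all_bicliques (fst z)))))"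
    and b: "poly_bounded ?e b"
    using ptime_answer unfolding ptime_def by blast
  obtain p where p: "\<And>z. b z \<le> poly p (tree_size (?e z))"
    using b unfolding poly_bounded_def by blast
  show ?thesis
  proof (intro exI[of _ c] exI[of _ p] allI impI)
    fix n k :: nat and G :: "nat ugraph"
    assume asm: "finite_simple_graph G \<and> verts G = {..<n} \<and> k \<ge> 1"
    define M where "M = map (\<lambda>v. map (\<lambda>u. u \<in> neighbors G v) [0..<n]) [0..<n]"
    interpret graph_instance G n M
      using asm by unfold_locales (auto simp: M_def)
    have inst: "enc_instance n G k = ?e (M, bits_of_nat k)"
      by (simp add: enc_instance_eq M_def)
    \<comment> \<open>The program works from every store with the input in variable 0, in particular
      from the initial store with \<open>Leaf\<close> elsewhere.\<close>
    obtain t s where "exec c ((\<lambda>_. Leaf)(0 := enc_instance n G k)) t s" "t \<le> b (M, bits_of_nat k)"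
      "s 0 = enc_answer n (answer_for k)"
      using runs_inD[OF c[of "(M, bits_of_nat k)"], of "(\<lambda>_. Leaf)(0 := enc_instance n G k)"]
      by (auto simp: inst enc_answer_for)
    moreover have "b (M, bits_of_nat k) \<le> poly p (tree_size (enc_instance n G k))"
      unfolding inst by (rule p)
    ultimately show "\<exists>t a. computes c (enc_instance n G k) t (enc_answer n a) \<and>
            t \<le> poly p (tree_size (enc_instance n G k)) \<and> correct_answer G k a"
      using correct_answer_for asm unfolding computes_def by (meson order_trans)
  qed
qed

end
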